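(* Let $\mu \in \mathcal{M}$ be such that $0 < \phi(\mu) < 1$, where $\phi(\mu) := \sup\{ t \in [0,\infty) \mid \mu \in \mathbb{B}_t(\mathcal{M}) \}$. Then the convolution power $\mu^{\boxplus t}$ is defined for every $t$ with $1-\phi(\mu) \le t \le 1$; that is, for each such $t$ there exists a probability measure $\mu^{\boxplus t} \in \mathcal{M}$ with $V_{\mu^{\boxplus t}} = t V_\mu$ on a common truncated cone.
   Context: $\mathcal{M}$ is the set of Borel probability measures on $\mathbb{R}$; $\mathbb{C}^+$ is the open upper half-plane. For $\mu \in \mathcal{M}$: $G_\mu(z) = \int_{\mathbb{R}} \frac{d\mu(s)}{z-s}$ is the Cauchy transform and $F_\mu(z) = 1/G_\mu(z)$ the reciprocal Cauchy transform; $F_\mu$ is an analytic self-map of $\mathbb{C}^+$. For every $\alpha>0$ there is $\beta>0$ such that $F_\mu$ has an analytic right inverse $F_\mu^{-1}$ on the truncated cone $\Gamma_{\alpha,\beta}=\{z\in\mathbb{C}^+ : |\Re z|<\alpha\,\Im z,\ \Im z>\beta\}$ with $F_\mu^{-1}(z)/z\to 1$ as $z\to\infty$ in $\Gamma_{\alpha,\beta}$; put $V_\mu(z) = F_\mu^{-1}(z)-z$ there. (In terms of the $R$-transform, $V_\mu(z) = zR_\mu(1/z)$.) For $t\ge 1$, the free additive convolution power $\mu^{\boxplus t}\in\mathcal{M}$ is the unique probability measure with $V_{\mu^{\boxplus t}} = tV_\mu$ on a common truncated cone; it is known to exist for all $t\ge1$, but in general need not exist for $0<t<1$. For $t>0$,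 the Boolean convolution power $\mu^{\uplus t}\in\mathcal{M}$ is the unique probability measure with $F_{\mu^{\uplus t}}(z) = tF_\mu(z)+(1-t)z$, $z\in\mathbb{C}^+$ (it always exists). For $t\ge0$, $\mathbb{B}_t:\mathcal{M}\to\mathcal{M}$ is $\mathbb{B}_t(\mu) = \bigl( \mu^{\boxplus(1+t)} \bigr)^{\uplus(1/(1+t))}$, and $\mathbb{B}_t(\mathcal{M})$ is its range. *)

theory Defs
  imports "HOL-Probability.Probability"
begin

definition borel_probs :: "real measure set" where
  "borel_probs = {\<mu>. real_distribution \<mu>}"

definition upper_half_plane :: "complex set" where
  "upper_half_plane = {z. Im z > 0}"

definition cauchy_transform :: "real measure \<Rightarrow> complex \<Rightarrow> complex" where
  "cauchy_transform \<mu> z = (LINT s|\<mu>. 1 / (z - complex_of_real s))"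

definition recip_cauchy :: "real measure \<Rightarrow> complex \<Rightarrow> complex" where
  "recip_cauchy \<mu> z = 1 / cauchy_transform \<mu> z"

definition trunc_cone :: "real \<Rightarrow> real \<Rightarrow> complex set" where
  "trunc_cone \<alpha> \<beta> = {z \<in> upper_half_plane. \<bar>Re z\<bar> < \<alpha> * Im z \<and> Im z > \<beta>}"

text \<open>
  The normalisation at infinity makes the right inverse unique on the cone, so the following
  two predicates determine \<open>H\<close> and \<open>V\<close> on \<open>trunc_cone \<alpha> \<beta>\<close>; their values elsewhere are irrelevant.
\<close>

definition recip_cauchy_inverse ::
    "real measure \<Rightarrow> real \<Rightarrow> real \<Rightarrow> (complex \<Rightarrow> complex) \<Rightarrow> bool" where
  "recip_cauchy_inverse \<mu> \<alpha> \<beta> H \<longleftrightarrow>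
     H holomorphic_on trunc_cone \<alpha> \<beta> \<and>
     H ` trunc_cone \<alpha> \<beta> \<subseteq> upper_half_plane \<and>
     (\<forall>z\<in>trunc_cone \<alpha> \<beta>. recip_cauchy \<mu> (H z) = z) \<and>
     ((\<lambda>z. H z / z) \<longlongrightarrow> 1) (inf at_infinity (principal (trunc_cone \<alpha> \<beta>)))"

definition voiculescu_transform ::
    "real measure \<Rightarrow> real \<Rightarrow> real \<Rightarrow> (complex \<Rightarrow> complex) \<Rightarrow> bool" where
  "voiculescu_transform \<mu> \<alpha> \<beta> V \<longleftrightarrow>
     (\<exists>H. recip_cauchy_inverse \<mu> \<alpha> \<beta> H \<and> (\<forall>z\<in>trunc_cone \<alpha> \<beta>. V z = H z - z))"

definition is_free_power :: "real measure \<Rightarrow> real \<Rightarrow> real measure \<Rightarrow> bool" where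
  "is_free_power \<mu> t \<nu> \<longleftrightarrow>
     \<nu> \<in> borel_probs \<and>
     (\<exists>\<alpha>>0. \<exists>\<beta>>0. \<exists>V W. voiculescu_transform \<mu> \<alpha> \<beta> V \<and> voiculescu_transform \<nu> \<alpha> \<beta> W \<and>
        (\<forall>z\<in>trunc_cone \<alpha> \<beta>. W z = complex_of_real t * V z))"

definition is_boolean_power :: "real measure \<Rightarrow> real \<Rightarrow> real measure \<Rightarrow> bool" where
  "is_boolean_power \<mu> t \<nu> \<longleftrightarrow>
     \<nu> \<in> borel_probs \<and>
     (\<forall>z\<in>upper_half_plane.
        recip_cauchy \<nu> z = complex_of_real t * recip_cauchy \<mu> z + complex_of_real (1 - t) * z)"

definition free_power :: "real measure \<Rightarrow> real \<Rightarrow> real measure" where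
  "free_power \<mu> t = (THE \<nu>. is_free_power \<mu> t \<nu>)"

definition boolean_power :: "real measure \<Rightarrow> real \<Rightarrow> real measure" where
  "boolean_power \<mu> t = (THE \<nu>. is_boolean_power \<mu> t \<nu>)"

definition BB :: "real \<Rightarrow> real measure \<Rightarrow> real measure" where
  "BB t \<mu> = boolean_power (free_power \<mu> (1 + t)) (1 / (1 + t))"

text \<open>The supremum is taken in \<open>ereal\<close> because it may be infinite.\<close>

definition free_div_indicator :: "real measure \<Rightarrow> ereal" where
  "free_div_indicator \<mu> = (SUP t\<in>{t. 0 \<le> t \<and> \<mu> \<in> BB t ` borel_probs}. ereal t)"

end

(* Write F = recip_cauchy, so that F - id ranges exactly over the Nevanlinna functions, that is the
   holomorphic maps f of the upper half-plane into its closure with f(iy) = o(y).  For such an f,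
   the measures M with F_M(w - c f(w)) = w + (t - c) f(w), where c, t >= 0, have Voiculescu
   transform -t f(J), where J inverts w + (t - c) f(w).  Hence passing from (c, t) to (c', t') with
   t' - c' = t - c is a free power with exponent t' / t, and the range of BB s consists of
   the pairs (s, 1).  By Montel's theorem the supremum phi is attained, so mu has parameters
   (phi, 1), and its free power with exponent t has parameters (t - (1 - phi), t), which are
   admissible exactly when t >= 1 - phi. *)

theory Submission
  imports Defs "HOL-Complex_Analysis.Complex_Analysis" "HOL-Real_Asymp.Real_Asymp"
begin

section \<open>The Schwarz--Pick inequality and Nevanlinna functions\<close>

text \<open>Passing to the limit matters at one exponent only: a member s < \<phi> of the index set
  already serves every t \<ge> 1 - s, and the limit is what reaches t = 1 - \<phi>, where c' drops
  to 0. It is possible because membership in the range yields \<open>f (z + s * g z) = g z\<close>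
  with g = F_\<mu> - id fixed: f is pinned at known points, and no inverse function appears. Two
  kinds of inverse have to be kept apart. \<omega> inverts w - c f(w) over the entire half-plane and
  yields measures; J inverts w + (t - c) f(w) only far out in a cone, where t - c may have either
  sign, and yields Voiculescu transforms. The Schwarz-Pick inequality is the common source of
  estimates: Harnack bounds, Lipschitz constants, injectivity and uniqueness of inverses all follow
  from it, starting from a growth condition on the imaginary axis alone. Turning an analytic
  function back into a measure is Nevanlinna's theorem, proved here by Poisson integrals and weak
  compactness. Since both kinds of power are definite descriptions, uniqueness has to be proved as
  well.\<close>

lemma in_upper_half_plane_iff [simp]: "z \<in> upper_half_plane \<longleftrightarrow> Im z > 0"
  by (simp add: upper_half_plane_def)

lemma open_upper_half_plane: "open upper_half_plane"
  unfolding upper_half_plane_def by (rule open_halfspace_Im_gt)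

lemma convex_upper_half_plane: "convex upper_half_plane"
  unfolding upper_half_plane_def by (rule convex_halfspace_Im_gt)

text \<open>Bridge between the pseudo-hyperbolic quotient |z - w| / |z - cnj w| and imaginary parts:
  it places Cayley quotients in the disc and clears the denominators of Schwarz-Pick.\<close>

lemma cmod_diff_cnj_sq:
  "(cmod (z - cnj w))\<^sup>2 = (cmod (z - w))\<^sup>2 + 4 * Im z * Im w"
  unfolding cmod_power2 by (simp add: power2_eq_square algebra_simps)

lemma diff_cnj_nonzero:
  assumes "Im z > 0" "Im w > 0"
  shows "z - cnj w \<noteq> 0"
  using assms by (auto simp: complex_eq_iff)

lemma cayley_in_disc:
  assumes "Im z > 0" "Im w > 0"
  shows "cmod ((z - w) / (z - cnj w)) < 1"
proof -
  have "(cmod (z - w))\<^sup>2 < (cmod (z - cnj w))\<^sup>2"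
    unfolding cmod_diff_cnj_sq using assms by simp
  then have "cmod (z - w) < cmod (z - cnj w)"
    by (simp add: power2_less_imp_less)
  then show ?thesis
    using diff_cnj_nonzero[OF assms] by (simp add: norm_divide)
qed

text \<open>The Moebius map here is inverse to the one in \<open>cayley_in_disc\<close> with w
  fixed; it sends 0 to w.\<close>

lemma inverse_cayley:
  assumes "Im w > 0" "cmod \<zeta> < 1"
  shows "Im ((w - \<zeta> * cnj w) / (1 - \<zeta>)) > 0"
proof -
  define d where "d = (1 - Re \<zeta>)\<^sup>2 + (Im \<zeta>)\<^sup>2"
  have ne: "1 - \<zeta> \<noteq> 0" using assms by auto
  have d: "d = (cmod (1 - \<zeta>))\<^sup>2"
    unfolding d_def cmod_power2 by simp
  have dpos: "d > 0" using ne d by simp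
  have "(cmod \<zeta>)\<^sup>2 < 1" using assms(2) by (simp add: abs_square_less_1)
  then have s: "(Re \<zeta>)\<^sup>2 + (Im \<zeta>)\<^sup>2 < 1" unfolding cmod_power2 .
  have "Im ((w - \<zeta> * cnj w) / (1 - \<zeta>)) = Im w * (1 - ((Re \<zeta>)\<^sup>2 + (Im \<zeta>)\<^sup>2)) / d"
    by (simp add: Im_divide d_def power2_eq_square algebra_simps)
  moreover have "\<dots> > 0" using s dpos assms(1) by simp
  ultimately show ?thesis by simp
qed

text \<open>Conjugation by the Cayley maps that move w and f w to 0 reduces this to the Schwarz
  lemma. After cross-multiplication the common product of squared distances cancels, which leaves an
  inequality without denominators that survives limits in which Im (f z) vanishes.\<close>

lemma schwarz_pick_open:
  assumes holf: "f holomorphic_on upper_half_plane"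
    and pos: "\<And>z. Im z > 0 \<Longrightarrow> Im (f z) > 0"
    and z: "Im z > 0" and w: "Im w > 0"
  shows "(cmod (f z - f w))\<^sup>2 * (Im z * Im w) \<le> (cmod (z - w))\<^sup>2 * (Im (f z) * Im (f w))"
proof -
  define C where "C = (\<lambda>\<zeta>. (w - \<zeta> * cnj w) / (1 - \<zeta>))"
  define D where "D = (\<lambda>u. (u - f w) / (u - cnj (f w)))"
  define h where "h = (\<lambda>\<zeta>. D (f (C \<zeta>)))"
  define \<xi> where "\<xi> = (z - w) / (z - cnj w)"
  have fw: "Im (f w) > 0" using pos w by simp
  have C_pos: "Im (C \<zeta>) > 0" if "cmod \<zeta> < 1" for \<zeta>
    unfolding C_def using inverse_cayley[OF w that] .
  have ne: "z - cnj w \<noteq> 0" by (rule diff_cnj_nonzero[OF z w])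
  have w_ne: "w - cnj w \<noteq> 0" by (rule diff_cnj_nonzero[OF w w])
  have C\<xi>: "C \<xi> = z"
  proof -
    have "1 - \<xi> = (w - cnj w) / (z - cnj w)"
      unfolding \<xi>_def using ne by (simp add: field_simps)
    moreover have "w - \<xi> * cnj w = z * (w - cnj w) / (z - cnj w)"
      unfolding \<xi>_def using ne by (simp add: field_simps)
    ultimately show ?thesis
      unfolding C_def using ne w_ne by simp
  qed
  have "C holomorphic_on ball 0 1"
    unfolding C_def by (intro holomorphic_intros) auto
  then have fC: "(\<lambda>\<zeta>. f (C \<zeta>)) holomorphic_on ball 0 1"
    using holomorphic_on_compose_gen[OF _ holf, of C "ball 0 1"] C_pos
    by (auto simp: o_def image_subset_iff)
  have h1: "h holomorphic_on ball 0 1"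
    unfolding h_def D_def
    by (intro holomorphic_intros fC) (use diff_cnj_nonzero[OF pos fw] C_pos in auto)
  have h0: "h 0 = 0" unfolding h_def D_def C_def by simp
  have h_less: "cmod (h \<zeta>) < 1" if "cmod \<zeta> < 1" for \<zeta>
    unfolding h_def D_def by (rule cayley_in_disc) (use pos C_pos that fw in auto)
  have "cmod \<xi> < 1" unfolding \<xi>_def by (rule cayley_in_disc[OF z w])
  then have "cmod (h \<xi>) \<le> cmod \<xi>"
    using Schwarz_Lemma(1)[OF h1 h0 h_less] by simp
  then have "cmod ((f z - f w) / (f z - cnj (f w))) \<le> cmod ((z - w) / (z - cnj w))"
    unfolding h_def C\<xi> unfolding D_def \<xi>_def .
  then have "(cmod (f z - f w))\<^sup>2 / (cmod (f z - cnj (f w)))\<^sup>2 \<le> (cmod (z - w))\<^sup>2 / (cmod (z - cnj w))\<^sup>2"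
    unfolding norm_divide power_divide[symmetric] by (rule power_mono) simp
  moreover have "(cmod (f z - cnj (f w)))\<^sup>2 > 0" "(cmod (z - cnj w))\<^sup>2 > 0"
    using diff_cnj_nonzero[OF pos fw, of z] z ne by auto
  ultimately have "(cmod (f z - f w))\<^sup>2 * (cmod (z - cnj w))\<^sup>2 \<le> (cmod (z - w))\<^sup>2 * (cmod (f z - cnj (f w)))\<^sup>2"
    by (simp add: field_simps)
  then show ?thesis unfolding cmod_diff_cnj_sq by (simp add: algebra_simps)
qed

text \<open>Adding i e makes the imaginary part strictly positive without changing differences; then
  e tends to 0. The closed version is needed since Nevanlinna functions may take real values, for
  instance as real constants.\<close>

lemma schwarz_pick:
  assumes holf: "f holomorphic_on upper_half_plane"
    and nonneg: "\<And>z. Im z > 0 \<Longrightarrow> Im (f z) \<ge> 0"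
    and z: "Im z > 0" and w: "Im w > 0"
  shows "(cmod (f z - f w))\<^sup>2 * (Im z * Im w) \<le> (cmod (z - w))\<^sup>2 * (Im (f z) * Im (f w))"
proof -
  have ev: "(cmod (f z - f w))\<^sup>2 * (Im z * Im w)
      \<le> (cmod (z - w))\<^sup>2 * ((Im (f z) + e) * (Im (f w) + e))" if "e > 0" for e
  proof -
    have "(cmod ((f z + \<i> * of_real e) - (f w + \<i> * of_real e)))\<^sup>2 * (Im z * Im w)
       \<le> (cmod (z - w))\<^sup>2 * (Im (f z + \<i> * of_real e) * Im (f w + \<i> * of_real e))"
    proof (rule schwarz_pick_open[of "\<lambda>z. f z + \<i> * of_real e"])
      show "(\<lambda>z. f z + \<i> * of_real e) holomorphic_on upper_half_plane"
        by (intro holomorphic_intros holf)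
      show "Im (f u + \<i> * of_real e) > 0" if "Im u > 0" for u
        using nonneg[OF that] \<open>e > 0\<close> by simp
    qed (use z w in auto)
    then show ?thesis by simp
  qed
  have "((\<lambda>e. (cmod (z - w))\<^sup>2 * ((Im (f z) + e) * (Im (f w) + e))) \<longlongrightarrow>
     (cmod (z - w))\<^sup>2 * ((Im (f z) + 0) * (Im (f w) + 0))) (at_right 0)"
    by (intro tendsto_intros)
  moreover have "eventually (\<lambda>e. (cmod (f z - f w))\<^sup>2 * (Im z * Im w)
      \<le> (cmod (z - w))\<^sup>2 * ((Im (f z) + e) * (Im (f w) + e))) (at_right (0::real))"
    using ev by (auto simp: eventually_at_right_field intro!: exI[of _ 1])
  ultimately show ?thesis
    using tendsto_lowerbound by fastforce
qed

text \<open>Schwarz-Pick gives the geometric mean of a and b, which is relaxed to the arithmetic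
  mean. Separate rates at z and w matter for subordination, where only one of the two points has a
  rate known to be below 1.\<close>

lemma schwarz_pick_lipschitz:
  assumes "f holomorphic_on upper_half_plane"
    and "\<And>z. Im z > 0 \<Longrightarrow> Im (f z) \<ge> 0"
    and "Im z > 0" "Im w > 0"
    and "Im (f z) \<le> a * Im z" "Im (f w) \<le> b * Im w"
  shows "cmod (f z - f w) \<le> (a + b) / 2 * cmod (z - w)"
proof -
  have a: "a \<ge> 0" using assms(2)[OF assms(3)] assms(3,5)
    by (metis mult_less_0_iff order.trans linorder_not_less)
  have b: "b \<ge> 0" using assms(2)[OF assms(4)] assms(4,6)
    by (metis mult_less_0_iff order.trans linorder_not_less)
  have "(cmod (f z - f w))\<^sup>2 * (Im z * Im w) \<le> (cmod (z - w))\<^sup>2 * (Im (f z) * Im (f w))"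
    by (rule schwarz_pick) (use assms in auto)
  also have "\<dots> \<le> (cmod (z - w))\<^sup>2 * ((a * Im z) * (b * Im w))"
    by (intro mult_left_mono mult_mono) (use assms a in auto)
  finally have "(cmod (f z - f w))\<^sup>2 * (Im z * Im w) \<le> ((cmod (z - w))\<^sup>2 * (a * b)) * (Im z * Im w)"
    by (simp add: algebra_simps)
  then have "(cmod (f z - f w))\<^sup>2 \<le> (cmod (z - w))\<^sup>2 * (a * b)"
    using assms(3,4) by (simp add: mult_le_cancel_right)
  also have "\<dots> \<le> (cmod (z - w))\<^sup>2 * ((a + b) / 2)\<^sup>2"
  proof (rule mult_left_mono)
    have "0 \<le> (a - b)\<^sup>2" by simp
    then show "a * b \<le> ((a + b) / 2)\<^sup>2" by (simp add: power2_eq_square algebra_simps)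
  qed simp
  finally have "(cmod (f z - f w))\<^sup>2 \<le> ((a + b) / 2 * cmod (z - w))\<^sup>2"
    by (simp only: power_mult_distrib mult.commute)
  then show ?thesis by (rule power2_le_imp_le) (use a b in auto)
qed

text \<open>A Harnack inequality for the modulus. With a = |f z| and b = |f w|, Schwarz-Pick yields
  (a - b)^2 \<le> K a b, hence a^2 \<le> (2 + K) a b, and a is cancelled.\<close>

lemma schwarz_pick_growth:
  assumes "f holomorphic_on upper_half_plane"
    and "\<And>z. Im z > 0 \<Longrightarrow> Im (f z) \<ge> 0"
    and "Im z > 0" "Im w > 0"
    and K: "(cmod (z - w))\<^sup>2 \<le> K * (Im z * Im w)" "K \<ge> 0"
  shows "cmod (f z) \<le> (2 + K) * cmod (f w)"
proof (cases "f z = 0")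
  case False
  define a b where "a = cmod (f z)" and "b = cmod (f w)"
  have "(cmod (f z - f w))\<^sup>2 * (Im z * Im w) \<le> (cmod (z - w))\<^sup>2 * (Im (f z) * Im (f w))"
    by (rule schwarz_pick) (use assms in auto)
  also have "\<dots> \<le> (K * (Im z * Im w)) * (a * b)"
    unfolding a_def b_def
    by (intro mult_mono K mult_nonneg_nonneg abs_Im_le_cmod[THEN order_trans[OF abs_ge_self]])
       (use assms in auto)
  finally have "(cmod (f z - f w))\<^sup>2 * (Im z * Im w) \<le> (K * (a * b)) * (Im z * Im w)"
    by (simp add: algebra_simps)
  then have "(cmod (f z - f w))\<^sup>2 \<le> K * (a * b)"
    using assms(3,4) by (simp add: mult_le_cancel_right)
  moreover have "(a - b)\<^sup>2 \<le> (cmod (f z - f w))\<^sup>2"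
    unfolding a_def b_def by (rule abs_le_square_iff[THEN iffD1]) (simp add: norm_triangle_ineq3)
  ultimately have "(a - b)\<^sup>2 \<le> K * (a * b)" by linarith
  then have "a * a + b * b \<le> (2 + K) * b * a" by (simp add: power2_eq_square algebra_simps)
  then have "a * a \<le> (2 + K) * b * a" using zero_le_square[of b] by linarith
  moreover have "a > 0" unfolding a_def using False by simp
  ultimately show ?thesis unfolding a_def b_def by (simp add: mult_le_cancel_right)
qed (use K in simp)

text \<open>By Nevanlinna's theorem these are the functions \<open>recip_cauchy \<nu> z - z\<close> with \<open>\<nu>\<close> a
  probability measure.\<close>

definition nevanlinna :: "(complex \<Rightarrow> complex) \<Rightarrow> bool" where
  "nevanlinna f \<longleftrightarrow> f holomorphic_on upper_half_plane \<and> (\<forall>z. Im z > 0 \<longrightarrow> Im (f z) \<ge> 0) \<and>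
     ((\<lambda>y. f (\<i> * of_real y) / of_real y) \<longlongrightarrow> 0) at_top"

lemma nevanlinnaD:
  assumes "nevanlinna f"
  shows "f holomorphic_on upper_half_plane" "\<And>z. Im z > 0 \<Longrightarrow> Im (f z) \<ge> 0"
    "((\<lambda>y. f (\<i> * of_real y) / of_real y) \<longlongrightarrow> 0) at_top"
  using assms by (auto simp: nevanlinna_def)

lemma nevanlinna_cmult:
  assumes "nevanlinna f" "c \<ge> 0"
  shows "nevanlinna (\<lambda>z. of_real c * f z)"
  unfolding nevanlinna_def
proof (intro conjI allI impI)
  show "(\<lambda>z. of_real c * f z) holomorphic_on upper_half_plane"
    by (intro holomorphic_intros nevanlinnaD[OF assms(1)])
  show "0 \<le> Im (of_real c * f z)" if "Im z > 0" for z
    using nevanlinnaD(2)[OF assms(1) that] assms(2) by simp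
  have "((\<lambda>y. of_real c * (f (\<i> * of_real y) / of_real y)) \<longlongrightarrow> of_real c * 0) at_top"
    by (intro tendsto_intros nevanlinnaD[OF assms(1)])
  then show "((\<lambda>y. of_real c * f (\<i> * of_real y) / of_real y) \<longlongrightarrow> 0) at_top"
    by simp
qed

text \<open>The definition controls f only on the imaginary axis. Harnack carries the bound
  sideways: |z - i Im z|^2 \<le> \<alpha>^2 (Im z)^2 in the cone, which costs the fixed factor 2 +
  \<alpha>^2.\<close>

lemma nevanlinna_small_on_cone:
  assumes "nevanlinna f" "\<delta> > 0" "\<alpha> \<ge> 0"
  obtains \<beta> where "\<beta> > 0"
    "\<And>z. Im z > \<beta> \<Longrightarrow> \<bar>Re z\<bar> \<le> \<alpha> * Im z \<Longrightarrow> cmod (f z) \<le> \<delta> * Im z"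
proof -
  define \<eta> where "\<eta> = \<delta> / (2 + \<alpha>\<^sup>2)"
  have \<eta>: "\<eta> > 0" unfolding \<eta>_def using assms by (simp add: add_pos_nonneg)
  have "\<forall>\<^sub>F y in at_top. dist (f (\<i> * of_real y) / of_real y) 0 < \<eta>"
    using nevanlinnaD(3)[OF assms(1)] \<eta> by (rule tendstoD)
  then obtain N where N: "\<And>y. y \<ge> N \<Longrightarrow> cmod (f (\<i> * of_real y) / of_real y) < \<eta>"
    unfolding eventually_at_top_linorder by auto
  show ?thesis
  proof (rule that)
    show "max N 1 > 0" by simp
    fix z assume z: "Im z > max N 1" "\<bar>Re z\<bar> \<le> \<alpha> * Im z"
    then have iz: "Im z > 0" by auto
    have "cmod (f (\<i> * of_real (Im z)) / of_real (Im z)) < \<eta>" by (rule N) (use z in auto)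
    then have 1: "cmod (f (\<i> * of_real (Im z))) \<le> \<eta> * Im z"
      using iz by (simp add: norm_divide field_simps)
    have "cmod (f z) \<le> (2 + \<alpha>\<^sup>2) * cmod (f (\<i> * of_real (Im z)))"
    proof (rule schwarz_pick_growth[of f])
      have "z - \<i> * of_real (Im z) = of_real (Re z)" by (simp add: complex_eq_iff)
      then have "(cmod (z - \<i> * of_real (Im z)))\<^sup>2 = \<bar>Re z\<bar>\<^sup>2" by simp
      also have "\<dots> \<le> (\<alpha> * Im z)\<^sup>2" using z by (intro power_mono) auto
      finally show "(cmod (z - \<i> * of_real (Im z)))\<^sup>2 \<le> \<alpha>\<^sup>2 * (Im z * Im (\<i> * of_real (Im z)))"
        by (simp add: power2_eq_square algebra_simps)
    qed (use nevanlinnaD[OF assms(1)] iz in auto)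
    also have "\<dots> \<le> (2 + \<alpha>\<^sup>2) * (\<eta> * Im z)" using 1 by (intro mult_left_mono) auto
    also have "\<dots> = \<delta> * Im z" unfolding \<eta>_def
      by (simp add: add_pos_nonneg less_imp_neq[symmetric])
    finally show "cmod (f z) \<le> \<delta> * Im z" .
  qed
qed

section \<open>Inverting perturbations of the identity\<close>

lemma eventually_at_infinity_within:
  fixes S :: "'a::real_normed_vector set"
  shows "eventually P (inf at_infinity (principal S)) \<longleftrightarrow> (\<exists>b. \<forall>z\<in>S. norm z \<ge> b \<longrightarrow> P z)"
  unfolding eventually_inf_principal eventually_at_infinity by auto

lemma cmod_le_on_cone:
  assumes "z \<in> trunc_cone \<alpha> \<beta>"
  shows "cmod z \<le> (1 + \<alpha>) * Im z"
  using assms cmod_le[of z] by (auto simp: trunc_cone_def algebra_simps)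

lemma trunc_cone_mono:
  "\<alpha> \<le> \<alpha>' \<Longrightarrow> \<beta>' \<le> \<beta> \<Longrightarrow> trunc_cone \<alpha> \<beta> \<subseteq> trunc_cone \<alpha>' \<beta>'"
  unfolding trunc_cone_def by (auto intro: order.strict_trans2 mult_right_mono)

lemma open_trunc_cone: "open (trunc_cone \<alpha> \<beta>)"
proof -
  have "trunc_cone \<alpha> \<beta> = {z. 0 < Im z} \<inter> {z. \<bar>Re z\<bar> < \<alpha> * Im z} \<inter> {z. \<beta> < Im z}"
    by (auto simp: trunc_cone_def)
  moreover have "open {z. \<bar>Re z\<bar> < \<alpha> * Im z}"
    by (intro open_Collect_less continuous_intros)
  ultimately show ?thesis
    by (simp add: open_Int open_halfspace_Im_gt)
qed

lemma imaginary_in_trunc_cone: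
  "\<alpha> > 0 \<Longrightarrow> y > 0 \<Longrightarrow> y > \<beta> \<Longrightarrow> \<i> * complex_of_real y \<in> trunc_cone \<alpha> \<beta>"
  by (simp add: trunc_cone_def)

text \<open>Far out in a cone f has a small Lipschitz constant, so
  \<open>w + \<kappa> f w = z\<close> is a contraction problem for \<kappa> of either sign.
  Injectivity makes the pointwise solutions one holomorphic function. The bound by \<delta> later
  keeps \<open>z - t f (J z)\<close> in the upper half-plane.\<close>

lemma perturbed_identity_right_inverse:
  assumes f: "nevanlinna f" and "\<delta> > 0"
  obtains \<beta> J where "\<beta> > 0" "J holomorphic_on trunc_cone 1 \<beta>"
    "\<And>z. z \<in> trunc_cone 1 \<beta> \<Longrightarrow> Im (J z) > 0"
    "\<And>z. z \<in> trunc_cone 1 \<beta> \<Longrightarrow> J z + of_real \<kappa> * f (J z) = z"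
    "\<And>z. z \<in> trunc_cone 1 \<beta> \<Longrightarrow> cmod (f (J z)) \<le> \<delta> * Im z"
    "((\<lambda>z. f (J z) / z) \<longlongrightarrow> 0) (inf at_infinity (principal (trunc_cone 1 \<beta>)))"
proof -
  \<comment> \<open>The first bound is halved because Im (J z) is only bounded by 2 Im z; the second
    makes \<kappa> f a contraction with factor 1/4.\<close>
  define \<epsilon> where "\<epsilon> = min (\<delta> / 2) (1 / (4 * (\<bar>\<kappa>\<bar> + 1)))"
  have \<epsilon>: "\<epsilon> > 0" "\<epsilon> \<le> \<delta> / 2" unfolding \<epsilon>_def using \<open>\<delta> > 0\<close> by auto
  have "\<epsilon> \<le> 1 / (4 * (\<bar>\<kappa>\<bar> + 1))" unfolding \<epsilon>_def by simp
  then have "(\<bar>\<kappa>\<bar> + 1) * \<epsilon> \<le> 1 / 4" by (simp add: field_simps)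
  then have \<kappa>\<epsilon>: "\<bar>\<kappa>\<bar> * \<epsilon> \<le> 1 / 4" using \<epsilon> by (simp add: algebra_simps)
  obtain b where b: "b > 0"
    and small: "\<And>w. Im w > b \<Longrightarrow> \<bar>Re w\<bar> \<le> 3 * Im w \<Longrightarrow> cmod (f w) \<le> \<epsilon> * Im w"
    using nevanlinna_small_on_cone[OF f \<epsilon>(1), of 3] by auto
  \<comment> \<open>Slope 3 leaves room for the disc of radius Im z / 2 about a point with |Re z| <
    Im z: there |Re w| < 3/2 Im z and Im w \<ge> Im z / 2. The latter also explains the height 2 * b
    imposed on z.\<close>
  define S where "S = trunc_cone 4 b \<inter> {w. \<bar>Re w\<bar> < 3 * Im w}"
  have S: "w \<in> S \<longleftrightarrow> Im w > b \<and> \<bar>Re w\<bar> < 3 * Im w" for w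
    unfolding S_def trunc_cone_def using b by auto
  have openS: "open S"
    unfolding S_def by (intro open_Int open_trunc_cone open_Collect_less continuous_intros)
  define H where "H = (\<lambda>w. w + of_real \<kappa> * f w)"
  have SC: "S \<subseteq> upper_half_plane" using S b by auto
  have lip: "cmod (f w - f w') \<le> \<epsilon> * cmod (w - w')" if "w \<in> S" "w' \<in> S" for w w'
  proof -
    have "cmod (f w - f w') \<le> (\<epsilon> + \<epsilon>) / 2 * cmod (w - w')"
    proof (rule schwarz_pick_lipschitz)
      show "Im (f w) \<le> \<epsilon> * Im w"
        using small[of w] that(1) S abs_Im_le_cmod[of "f w"] by fastforce
      show "Im (f w') \<le> \<epsilon> * Im w'"
        using small[of w'] that(2) S abs_Im_le_cmod[of "f w'"] by fastforce
    qed (use nevanlinnaD[OF f] that S b in auto)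
    then show ?thesis by simp
  qed
  have lip\<kappa>: "cmod (of_real \<kappa> * f w - of_real \<kappa> * f w') \<le> 1 / 4 * cmod (w - w')"
    if "w \<in> S" "w' \<in> S" for w w'
  proof -
    have "cmod (of_real \<kappa> * f w - of_real \<kappa> * f w') = \<bar>\<kappa>\<bar> * cmod (f w - f w')"
      by (simp add: right_diff_distrib[symmetric] norm_mult)
    also have "\<dots> \<le> \<bar>\<kappa>\<bar> * (\<epsilon> * cmod (w - w'))"
      by (intro mult_left_mono lip that) auto
    also have "\<dots> = (\<bar>\<kappa>\<bar> * \<epsilon>) * cmod (w - w')" by simp
    also have "\<dots> \<le> 1 / 4 * cmod (w - w')"
      by (intro mult_right_mono \<kappa>\<epsilon>) auto
    finally show ?thesis .
  qed
  have inj: "inj_on H S"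
  proof (rule inj_onI)
    fix w w' assume w: "w \<in> S" "w' \<in> S" "H w = H w'"
    then have "w - w' = - (of_real \<kappa> * f w - of_real \<kappa> * f w')"
      unfolding H_def by (simp add: algebra_simps)
    then have "cmod (w - w') = cmod (of_real \<kappa> * f w - of_real \<kappa> * f w')" by (simp only: norm_minus_cancel)
    then have "cmod (w - w') \<le> 1 / 4 * cmod (w - w')" using lip\<kappa>[OF w(1,2)] by simp
    then have "cmod (w - w') \<le> 0" by simp
    then show "w = w'" by simp
  qed
  have holf: "f holomorphic_on S"
    using nevanlinnaD(1)[OF f] SC by (rule holomorphic_on_subset)
  have holH: "H holomorphic_on S"
    unfolding H_def by (intro holomorphic_intros holf)
  obtain J where J: "J holomorphic_on (H ` S)" "\<And>w. w \<in> S \<Longrightarrow> J (H w) = w"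
    by (rule holomorphic_has_inverse[OF holH openS inj]) blast
  have ex: "\<exists>w\<in>S. H w = z \<and> cmod (w - z) \<le> Im z / 2" if z: "z \<in> trunc_cone 1 (2 * b)" for z
  proof -
    \<comment> \<open>Fixed points of T are the solutions of \<open>H w = z\<close>; Banach's
      theorem applies on the closed disc of radius Im z / 2 about z.\<close>
    define T where "T = (\<lambda>w. z - of_real \<kappa> * f w)"
    have y: "Im z > 2 * b" "\<bar>Re z\<bar> < Im z" using z by (auto simp: trunc_cone_def)
    have in_ball: "w \<in> S \<and> Im w \<le> 2 * Im z" if "w \<in> cball z (Im z / 2)" for w
    proof -
      have d: "cmod (w - z) \<le> Im z / 2" using that by (simp add: dist_norm norm_minus_commute)
      have "\<bar>Re w - Re z\<bar> \<le> Im z / 2" "\<bar>Im w - Im z\<bar> \<le> Im z / 2"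
        using abs_Re_le_cmod[of "w - z"] abs_Im_le_cmod[of "w - z"] d by auto
      then show ?thesis unfolding S using y b by (intro conjI; linarith)
    qed
    have "\<exists>!w\<in>cball z (Im z / 2). T w = w"
    proof (rule Banach_fix[OF compact_imp_complete[OF compact_cball]])
      show "cball z (Im z / 2) \<noteq> {}" using y b by auto
      show "T ` cball z (Im z / 2) \<subseteq> cball z (Im z / 2)"
      proof (rule image_subsetI)
        fix w assume w: "w \<in> cball z (Im z / 2)"
        have "cmod (of_real \<kappa> * f w) = \<bar>\<kappa>\<bar> * cmod (f w)" by (simp add: norm_mult)
        also have "\<dots> \<le> \<bar>\<kappa>\<bar> * (\<epsilon> * Im w)"
          by (intro mult_left_mono small) (use in_ball[OF w] S in auto)
        also have "\<dots> = (\<bar>\<kappa>\<bar> * \<epsilon>) * Im w" by simp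
        also have "\<dots> \<le> 1 / 4 * Im w"
          by (intro mult_right_mono \<kappa>\<epsilon>) (use in_ball[OF w] S b in auto)
        also have "\<dots> \<le> Im z / 2" using in_ball[OF w] by simp
        finally show "T w \<in> cball z (Im z / 2)" unfolding T_def by (simp add: dist_norm)
      qed
      show "dist (T x) (T x') \<le> 1 / 4 * dist x x'"
        if "x \<in> cball z (Im z / 2)" "x' \<in> cball z (Im z / 2)" for x x'
      proof -
        have "cmod (of_real \<kappa> * f x - of_real \<kappa> * f x') \<le> 1 / 4 * cmod (x - x')"
          using in_ball that by (intro lip\<kappa>) auto
        then show "dist (T x) (T x') \<le> 1 / 4 * dist x x'"
          unfolding T_def by (simp add: dist_norm norm_minus_commute)
      qed
    qed auto
    then obtain w where w: "w \<in> cball z (Im z / 2)" "T w = w" by auto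
    then have "H w = z" unfolding H_def T_def by (simp add: algebra_simps)
    then show ?thesis using in_ball[OF w(1)] w(1)
      by (auto simp: dist_norm norm_minus_commute)
  qed
  have Jz: "J z \<in> S" "H (J z) = z" "cmod (J z - z) \<le> Im z / 2" "z \<in> H ` S"
    if "z \<in> trunc_cone 1 (2 * b)" for z
    using ex[OF that] J(2) by auto
  have ImJ: "Im (J z) \<le> 2 * Im z" "Im (J z) \<ge> Im z / 2" if z: "z \<in> trunc_cone 1 (2 * b)" for z
  proof -
    have "\<bar>Im (J z) - Im z\<bar> \<le> Im z / 2"
      using Jz(3)[OF z] abs_Im_le_cmod[of "J z - z"] by auto
    moreover have "Im z > 0" using z by (simp add: trunc_cone_def)
    ultimately show "Im (J z) \<le> 2 * Im z" "Im (J z) \<ge> Im z / 2" by linarith+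
  qed
  show ?thesis
  proof (rule that[of "2 * b" J])
    show "2 * b > 0" using b by simp
    show "J holomorphic_on trunc_cone 1 (2 * b)"
      using J(1) Jz(4) by (meson holomorphic_on_subset subsetI)
    show "Im (J z) > 0" if "z \<in> trunc_cone 1 (2 * b)" for z
      using Jz(1)[OF that] S b by auto
    show "J z + of_real \<kappa> * f (J z) = z" if "z \<in> trunc_cone 1 (2 * b)" for z
      using Jz(2)[OF that] by (simp add: H_def)
    show "cmod (f (J z)) \<le> \<delta> * Im z" if z: "z \<in> trunc_cone 1 (2 * b)" for z
    proof -
      have "cmod (f (J z)) \<le> \<epsilon> * Im (J z)" using small Jz(1)[OF z] S by auto
      also have "\<dots> \<le> \<delta> / 2 * (2 * Im z)"
        by (intro mult_mono \<epsilon> ImJ z) (use \<open>\<delta> > 0\<close> Jz(1)[OF z] S b in auto)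
      finally show ?thesis by simp
    qed
    show "((\<lambda>z. f (J z) / z) \<longlongrightarrow> 0) (inf at_infinity (principal (trunc_cone 1 (2 * b))))"
    proof (rule tendstoI)
      fix e :: real assume e: "e > 0"
      obtain b' where b': "b' > 0"
        and small': "\<And>w. Im w > b' \<Longrightarrow> \<bar>Re w\<bar> \<le> 3 * Im w \<Longrightarrow> cmod (f w) \<le> e / 3 * Im w"
        using nevanlinna_small_on_cone[OF f, of "e / 3" 3] e by auto
      \<comment> \<open>On the cone of slope 1, |z| \<le> 2 Im z, so |z| \<ge> 5 b' gives Im (J z)
        \<ge> Im z / 2 \<ge> 5 b' / 4 > b'.\<close>
      have "dist (f (J z) / z) 0 < e" if z: "z \<in> trunc_cone 1 (2 * b)" and nz: "cmod z \<ge> 5 * b'" for z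
      proof -
        have zpos: "cmod z > 0" using nz b' by linarith
        have "Im (J z) \<ge> Im z / 2" by (rule ImJ(2)[OF z])
        moreover have "5 * b' \<le> 2 * Im z" using nz cmod_le_on_cone[OF z] by simp
        ultimately have "Im (J z) > b'" using b' by simp
        then have "cmod (f (J z)) \<le> e / 3 * Im (J z)"
          using small' Jz(1)[OF z] S by auto
        also have "\<dots> \<le> e / 3 * (2 * Im z)" by (intro mult_left_mono ImJ z) (use e in auto)
        also have "\<dots> \<le> e / 3 * (2 * cmod z)"
          using abs_Im_le_cmod[of z] e by (intro mult_left_mono) linarith+
        also have "\<dots> < e * cmod z" using zpos e by simp
        finally show ?thesis using zpos by (simp add: norm_divide pos_divide_less_eq)
      qed
      then show "\<forall>\<^sub>F z in inf at_infinity (principal (trunc_cone 1 (2 * b))). dist (f (J z) / z) 0 < e"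
        unfolding eventually_at_infinity_within by blast
    qed
  qed
qed

text \<open>The image under \<open>id - g\<close> of the set \<Omega> of points that it keeps in the
  half-plane is nonempty, open and relatively closed, hence the whole half-plane by connectedness;
  Schwarz-Pick makes the map injective on \<Omega>. The last clause is left invertibility, through
  which solutions are later identified.\<close>

lemma nevanlinna_subordination:
  assumes g: "nevanlinna g"
  obtains \<omega> where "\<omega> holomorphic_on upper_half_plane"
    "\<And>z. Im z > 0 \<Longrightarrow> Im (\<omega> z) > 0"
    "\<And>z. Im z > 0 \<Longrightarrow> \<omega> z - g (\<omega> z) = z"
    "\<And>w. Im w > 0 \<Longrightarrow> Im (w - g w) > 0 \<Longrightarrow> \<omega> (w - g w) = w"
proof -
  define H where "H = (\<lambda>w. w - g w)"
  define \<Omega> where "\<Omega> = {w \<in> upper_half_plane. H w \<in> upper_half_plane}"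
  have \<Omega>: "w \<in> \<Omega> \<longleftrightarrow> Im w > 0 \<and> Im (H w) > 0" for w unfolding \<Omega>_def by simp
  have holH: "H holomorphic_on upper_half_plane"
    unfolding H_def by (intro holomorphic_intros nevanlinnaD[OF g])
  have open\<Omega>: "open \<Omega>"
    using continuous_open_preimage[OF holomorphic_on_imp_continuous_on[OF holH]
        open_upper_half_plane open_upper_half_plane]
    unfolding \<Omega>_def vimage_def Int_def by simp
  have holH\<Omega>: "H holomorphic_on \<Omega>"
    using holH by (rule holomorphic_on_subset) (auto simp: \<Omega>_def)
  \<comment> \<open>Since Im (g w1) = (1 - q) Im w1 and Im (g w2) \<le> Im w2, g has difference
    quotient at most 1 - q/2 for this pair, so H expands by at least q/2. The factor depends on w1
    alone, hence one fixed w1 controls all w2.\<close>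
  have expand: "cmod (w1 - w2) \<le> 2 * cmod (H w1 - H w2) * (Im w1 / Im (H w1))"
    if w1: "w1 \<in> \<Omega>" and w2: "w2 \<in> \<Omega>" for w1 w2
  proof -
    define q where "q = Im (H w1) / Im w1"
    have q: "q > 0" unfolding q_def using w1 \<Omega> by simp
    have "cmod (g w1 - g w2) \<le> ((1 - q) + 1) / 2 * cmod (w1 - w2)"
    proof (rule schwarz_pick_lipschitz)
      show "Im (g w1) \<le> (1 - q) * Im w1"
        unfolding q_def using w1 \<Omega> by (simp add: H_def field_simps)
      show "Im (g w2) \<le> 1 * Im w2" using w2 \<Omega> by (simp add: H_def)
    qed (use nevanlinnaD[OF g] w1 w2 \<Omega> in auto)
    moreover have "cmod (w1 - w2) \<le> cmod (H w1 - H w2) + cmod (g w1 - g w2)"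
      using norm_triangle_ineq[of "H w1 - H w2" "g w1 - g w2"] by (simp add: H_def)
    ultimately have "q * cmod (w1 - w2) \<le> 2 * cmod (H w1 - H w2)" by (simp add: algebra_simps)
    then have "cmod (w1 - w2) \<le> 2 * cmod (H w1 - H w2) / q"
      using q by (simp add: field_simps)
    then show ?thesis unfolding q_def by simp
  qed
  have inj: "inj_on H \<Omega>"
  proof (rule inj_onI)
    fix w w' assume w: "w \<in> \<Omega>" "w' \<in> \<Omega>" "H w = H w'"
    show "w = w'" using expand[OF w(1,2)] w(3) by simp
  qed
  have open_im: "open (H ` \<Omega>)" by (rule open_mapping_thm3[OF holH\<Omega> open\<Omega> inj])
  have sub: "H ` \<Omega> \<subseteq> upper_half_plane" using \<Omega> by auto
  \<comment> \<open>A point far up the imaginary axis has a preimage by the contraction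
    argument.\<close>
  have ne: "H ` \<Omega> \<noteq> {}"
  proof -
    obtain \<beta> J where J: "\<beta> > 0"
      "\<And>z. z \<in> trunc_cone 1 \<beta> \<Longrightarrow> Im (J z) > 0"
      "\<And>z. z \<in> trunc_cone 1 \<beta> \<Longrightarrow> J z + of_real (- 1) * g (J z) = z"
      by (rule perturbed_identity_right_inverse[OF g zero_less_one, where \<kappa> = "-1"]) blast
    define z where "z = \<i> * complex_of_real (\<beta> + 1)"
    have z: "z \<in> trunc_cone 1 \<beta>" unfolding z_def
      by (rule imaginary_in_trunc_cone) (use J(1) in auto)
    have "H (J z) = z" using J(3)[OF z] by (simp add: H_def)
    moreover have "Im z > 0" using J(1) by (simp add: z_def)
    ultimately have "J z \<in> \<Omega>" using J(2)[OF z] \<Omega> by simp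
    then show ?thesis by blast
  qed
  \<comment> \<open>Preimages of a convergent sequence stay bounded by \<open>expand\<close> with w
    0 fixed, so a subsequence converges. Since Im w \<ge> Im (H w), the limit keeps imaginary part
    at least Im z and cannot reach the boundary.\<close>
  have closed: "z \<in> H ` \<Omega>" if z: "Im z > 0" "z \<in> closure (H ` \<Omega>)" for z
  proof -
    obtain x where x: "\<And>n. x n \<in> H ` \<Omega>" "x \<longlonglongrightarrow> z"
      using z(2) unfolding closure_sequential by auto
    then have "\<forall>n. \<exists>w\<in>\<Omega>. x n = H w" by blast
    then obtain w where w: "\<And>n. w n \<in> \<Omega>" "\<And>n. x n = H (w n)" by metis
    have "bounded (range x)" using x(2) by (rule convergent_imp_bounded)
    then obtain B where B: "\<And>n. cmod (x n) \<le> B" by (auto simp: bounded_iff)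
    have "bounded (range w)"
      unfolding bounded_iff
    proof (intro exI ballI)
      fix u assume "u \<in> range w"
      then obtain n where u: "u = w n" by auto
      have "cmod (w 0 - w n) \<le> 2 * cmod (x 0 - x n) * (Im (w 0) / Im (H (w 0)))"
        using expand[OF w(1) w(1), of 0 n] w(2) by simp
      also have "\<dots> \<le> 2 * (B + B) * (Im (w 0) / Im (H (w 0)))"
      proof (rule mult_right_mono)
        show "2 * cmod (x 0 - x n) \<le> 2 * (B + B)"
          using norm_triangle_ineq4[of "x 0" "x n"] B[of 0] B[of n] by simp
        show "Im (w 0) / Im (H (w 0)) \<ge> 0" using w(1)[of 0] \<Omega> by simp
      qed
      finally show "cmod u \<le> cmod (w 0) + 2 * (B + B) * (Im (w 0) / Im (H (w 0)))"
        using norm_triangle_ineq4[of "w 0" "w 0 - w n"] u by simp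
    qed
    then obtain l r where r: "strict_mono (r :: nat \<Rightarrow> nat)" "(w \<circ> r) \<longlonglongrightarrow> l"
      using bounded_imp_convergent_subsequence by blast
    have xr: "(x \<circ> r) \<longlonglongrightarrow> z" by (rule LIMSEQ_subseq_LIMSEQ[OF x(2) r(1)])
    have "Im z \<le> Im l"
    proof (rule tendsto_le[OF sequentially_bot])
      show "(\<lambda>n. Im ((w \<circ> r) n)) \<longlonglongrightarrow> Im l" using r(2) by (rule tendsto_Im)
      show "(\<lambda>n. Im ((x \<circ> r) n)) \<longlonglongrightarrow> Im z" using xr by (rule tendsto_Im)
      have "Im (x n) \<le> Im (w n)" for n
        using nevanlinnaD(2)[OF g, of "w n"] w[of n] \<Omega> by (simp add: H_def)
      then show "\<forall>\<^sub>F n in sequentially. Im ((x \<circ> r) n) \<le> Im ((w \<circ> r) n)" by simp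
    qed
    then have l: "Im l > 0" using z by simp
    have "isCont H l"
      using holH l open_upper_half_plane
      by (meson continuous_on_eq_continuous_at holomorphic_on_imp_continuous_on in_upper_half_plane_iff)
    then have "(\<lambda>n. H ((w \<circ> r) n)) \<longlonglongrightarrow> H l" using r(2) by (rule isCont_tendsto_compose)
    moreover have "(\<lambda>n. H ((w \<circ> r) n)) = x \<circ> r" using w(2) by (auto simp: o_def)
    ultimately have "H l = z" using xr LIMSEQ_unique by metis
    moreover from this have "l \<in> \<Omega>" using l z \<Omega> by simp
    ultimately show ?thesis by blast
  qed
  have onto: "H ` \<Omega> = upper_half_plane"
  proof -
    have "connected upper_half_plane"
      by (rule convex_connected[OF convex_upper_half_plane])
    moreover have "openin (top_of_set upper_half_plane) (H ` \<Omega>)"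
      using open_im sub by (simp add: open_subset)
    moreover have "closedin (top_of_set upper_half_plane) (H ` \<Omega>)"
    proof -
      have "H ` \<Omega> = upper_half_plane \<inter> closure (H ` \<Omega>)"
        using closed sub closure_subset[of "H ` \<Omega>"] by auto
      then show ?thesis by (metis closed_closure closedin_closed_Int)
    qed
    ultimately show ?thesis using ne unfolding connected_clopen by blast
  qed
  obtain \<omega> where \<omega>: "\<omega> holomorphic_on (H ` \<Omega>)" "\<And>w. w \<in> \<Omega> \<Longrightarrow> \<omega> (H w) = w"
    by (rule holomorphic_has_inverse[OF holH\<Omega> open\<Omega> inj]) blast
  have im: "\<exists>w\<in>\<Omega>. z = H w" if "Im z > 0" for z
    using that onto by (metis image_iff in_upper_half_plane_iff)
  show ?thesis
  proof (rule that[of \<omega>])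
    show "\<omega> holomorphic_on upper_half_plane" using \<omega>(1) unfolding onto .
    show "Im (\<omega> z) > 0" if "Im z > 0" for z using im[OF that] \<omega>(2) \<Omega> by auto
    show "\<omega> z - g (\<omega> z) = z" if "Im z > 0" for z using im[OF that] \<omega>(2) by (auto simp: H_def)
    show "\<omega> (w - g w) = w" if "Im w > 0" "Im (w - g w) > 0" for w
      using \<omega>(2)[of w] that \<Omega> by (simp add: H_def)
  qed
qed

section \<open>The Cauchy transform\<close>

lemma cauchy_kernel_bound:
  assumes "Im z > 0"
  shows "cmod (1 / (z - of_real s)) \<le> 1 / Im z"
proof -
  have "Im z \<le> cmod (z - of_real s)" using abs_Im_le_cmod[of "z - of_real s"] by simp
  then show ?thesis using assms by (simp add: norm_divide frac_le)
qed

lemma cauchy_kernel_nonzero: "Im z > 0 \<Longrightarrow> z - of_real s \<noteq> 0"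
  by (auto simp: complex_eq_iff)

lemma Im_cauchy_kernel:
  "Im (1 / (z - of_real s)) = - (Im z * (cmod (1 / (z - of_real s)))\<^sup>2)"
  by (simp add: Im_divide norm_divide power_divide cmod_power2)

context real_distribution
begin

lemma prob_UNIV [simp]: "prob UNIV = 1"
  using prob_space by simp

lemma integrable_bounded_continuous:
  fixes f :: "real \<Rightarrow> 'b :: {banach, second_countable_topology}"
  assumes "continuous_on UNIV f" "\<And>s. norm (f s) \<le> B"
  shows "integrable M f"
proof (rule integrable_const_bound)
  show "f \<in> borel_measurable M"
    using borel_measurable_continuous_onI[OF assms(1)] by simp
qed (use assms(2) in auto)

lemma integrable_cauchy_kernel:
  assumes "Im z > 0"
  shows "integrable M (\<lambda>s. 1 / (z - of_real s))"
  by (rule integrable_bounded_continuous[OF _ cauchy_kernel_bound[OF assms]])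
     (intro continuous_intros, use cauchy_kernel_nonzero[OF assms] in auto)

text \<open>Direct estimate of the difference quotient: its error has kernel (u - z) / ((u - s) (z -
  s)^2), bounded uniformly in s once Im u > Im z / 2.\<close>

lemma cauchy_transform_holomorphic: "cauchy_transform M holomorphic_on upper_half_plane"
proof (rule holomorphic_onI)
  fix z assume "z \<in> upper_half_plane"
  then have y: "Im z > 0" by simp
  define D where "D = (LINT s|M. - ((1 / (z - of_real s)) * (1 / (z - of_real s))))"
  have int2: "integrable M (\<lambda>s. (1 / (u - of_real s)) * (1 / (z - of_real s)))" if "Im u > 0" for u
  proof (rule integrable_bounded_continuous)
    show "continuous_on UNIV (\<lambda>s. (1 / (u - of_real s)) * (1 / (z - of_real s)))"
      by (intro continuous_intros) (use cauchy_kernel_nonzero that y in auto)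
    show "cmod ((1 / (u - of_real s)) * (1 / (z - of_real s))) \<le> 1 / Im u * (1 / Im z)" for s
      unfolding norm_mult using cauchy_kernel_bound y that by (intro mult_mono) auto
  qed
  have bound: "cmod ((cauchy_transform M u - cauchy_transform M z) / (u - z) - D)
      \<le> cmod (u - z) * (2 / Im z ^ 3)" if u: "cmod (u - z) < Im z / 2" "u \<noteq> z" for u
  proof -
    have "\<bar>Im u - Im z\<bar> < Im z / 2" using abs_Im_le_cmod[of "u - z"] u by simp
    then have yu: "Im u > Im z / 2" by linarith
    then have yu0: "Im u > 0" using y by simp
    have "cauchy_transform M u - cauchy_transform M z
        = (LINT s|M. 1 / (u - of_real s) - 1 / (z - of_real s))"
      unfolding cauchy_transform_def
      by (rule Bochner_Integration.integral_diff[symmetric]) (intro integrable_cauchy_kernel yu0 y)+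
    also have "\<dots> = (LINT s|M. (u - z) * - ((1 / (u - of_real s)) * (1 / (z - of_real s))))"
    proof (rule Bochner_Integration.integral_cong[OF refl])
      fix s
      have "1 / a - 1 / b = (a - b) * - ((1 / a) * (1 / b))" if "a \<noteq> 0" "b \<noteq> 0" for a b :: complex
        using that by (simp add: field_simps)
      from this[OF cauchy_kernel_nonzero[OF yu0] cauchy_kernel_nonzero[OF y], of s s]
      show "1 / (u - of_real s) - 1 / (z - of_real s)
          = (u - z) * - ((1 / (u - of_real s)) * (1 / (z - of_real s)))"
        by simp
    qed
    also have "\<dots> = (u - z) * (LINT s|M. - ((1 / (u - of_real s)) * (1 / (z - of_real s))))"
      by (rule integral_mult_right_zero)
    finally have "(cauchy_transform M u - cauchy_transform M z) / (u - z) - D =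
       (LINT s|M. - ((1 / (u - of_real s)) * (1 / (z - of_real s)))) - D" using u by simp
    also have "\<dots> = (LINT s|M. - ((1 / (u - of_real s)) * (1 / (z - of_real s)))
         - - ((1 / (z - of_real s)) * (1 / (z - of_real s))))"
      unfolding D_def
      by (rule Bochner_Integration.integral_diff[symmetric])
         (intro Bochner_Integration.integrable_minus int2 yu0 y)+
    finally have eq: "(cauchy_transform M u - cauchy_transform M z) / (u - z) - D = \<dots>" .
    have "cmod (LINT s|M. - ((1 / (u - of_real s)) * (1 / (z - of_real s)))
         - - ((1 / (z - of_real s)) * (1 / (z - of_real s)))) \<le> (LINT s|M. cmod (u - z) * (2 / Im z ^ 3))"
    proof (rule Bochner_Integration.integral_norm_bound_integral)
      show "integrable M (\<lambda>s. - ((1 / (u - of_real s)) * (1 / (z - of_real s)))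
         - - ((1 / (z - of_real s)) * (1 / (z - of_real s))))"
        by (intro Bochner_Integration.integrable_diff Bochner_Integration.integrable_minus int2 yu0 y)
      fix s
      have "- ((1 / (u - of_real s)) * (1 / (z - of_real s))) - - ((1 / (z - of_real s)) * (1 / (z - of_real s)))
         = (u - z) * ((1 / (u - of_real s)) * ((1 / (z - of_real s)) * (1 / (z - of_real s))))"
      proof -
        have "- ((1 / a) * (1 / b)) - - ((1 / b) * (1 / b)) = (a - b) * ((1 / a) * ((1 / b) * (1 / b)))"
          if "a \<noteq> 0" "b \<noteq> 0" for a b :: complex
          using that by (simp add: field_simps)
        from this[OF cauchy_kernel_nonzero[OF yu0] cauchy_kernel_nonzero[OF y], of s s]
        show ?thesis by simp
      qed
      also have "cmod \<dots> = cmod (u - z) * (cmod (1 / (u - of_real s)) * (cmod (1 / (z - of_real s)) * cmod (1 / (z - of_real s))))"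
        unfolding norm_mult ..
      also have "\<dots> \<le> cmod (u - z) * (1 / (Im z / 2) * (1 / Im z * (1 / Im z)))"
      proof (intro mult_left_mono mult_mono cauchy_kernel_bound y)
        have "cmod (1 / (u - of_real s)) \<le> 1 / Im u" by (rule cauchy_kernel_bound[OF yu0])
        also have "\<dots> \<le> 1 / (Im z / 2)" using y yu by (intro divide_left_mono) auto
        finally show "cmod (1 / (u - of_real s)) \<le> 1 / (Im z / 2)" .
      qed (use y in auto)
      also have "\<dots> = cmod (u - z) * (2 / Im z ^ 3)" by (simp add: power3_eq_cube)
      finally show "cmod (- ((1 / (u - of_real s)) * (1 / (z - of_real s))) - - ((1 / (z - of_real s)) * (1 / (z - of_real s))))
         \<le> cmod (u - z) * (2 / Im z ^ 3)" .
    qed simp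
    then show ?thesis unfolding eq by (simp add: prob_space)
  qed
  have "((\<lambda>u. (cauchy_transform M u - cauchy_transform M z) / (u - z) - D) \<longlongrightarrow> 0) (at z)"
  proof (rule Lim_null_comparison)
    show "\<forall>\<^sub>F u in at z. cmod ((cauchy_transform M u - cauchy_transform M z) / (u - z) - D)
       \<le> cmod (u - z) * (2 / Im z ^ 3)"
      unfolding eventually_at using bound y
      by (auto simp: dist_norm intro!: exI[of _ "Im z / 2"])
    have "((\<lambda>u. cmod (u - z) * (2 / Im z ^ 3)) \<longlongrightarrow> cmod (z - z) * (2 / Im z ^ 3)) (at z)"
      by (intro tendsto_intros)
    then show "((\<lambda>u. cmod (u - z) * (2 / Im z ^ 3)) \<longlongrightarrow> 0) (at z)" by simp
  qed
  then have "(cauchy_transform M has_field_derivative D) (at z)"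
    unfolding has_field_derivative_iff by (rule LIM_zero_cancel)
  then show "cauchy_transform M field_differentiable at z within upper_half_plane"
    using field_differentiable_def field_differentiable_at_within by blast
qed

lemma integrable_cauchy_kernel_sq:
  assumes "Im z > 0"
  shows "integrable M (\<lambda>s. (cmod (1 / (z - of_real s)))\<^sup>2)"
proof (rule integrable_bounded_continuous)
  show "continuous_on UNIV (\<lambda>s. (cmod (1 / (z - of_real s)))\<^sup>2)"
    by (intro continuous_intros) (use cauchy_kernel_nonzero assms in auto)
  show "norm ((cmod (1 / (z - of_real s)))\<^sup>2) \<le> (1 / Im z)\<^sup>2" for s
    using power_mono[OF cauchy_kernel_bound[OF assms, of s], of 2] by simp
qed

lemma Im_cauchy_transform:
  assumes "Im z > 0"
  shows "Im (cauchy_transform M z) = - (Im z * (LINT s|M. (cmod (1 / (z - of_real s)))\<^sup>2))"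
proof -
  have "Im (cauchy_transform M z) = (LINT s|M. Im (1 / (z - of_real s)))"
    unfolding cauchy_transform_def
    by (rule integral_bounded_linear[OF bounded_linear_Im integrable_cauchy_kernel[OF assms], symmetric])
  also have "\<dots> = (LINT s|M. - (Im z * (cmod (1 / (z - of_real s)))\<^sup>2))"
    by (rule Bochner_Integration.integral_cong[OF refl]) (rule Im_cauchy_kernel)
  finally show ?thesis by simp
qed

lemma Im_cauchy_transform_neg:
  assumes "Im z > 0"
  shows "Im (cauchy_transform M z) < 0"
proof -
  have "(LINT s|M. 0) < (LINT s|M. (cmod (1 / (z - of_real s)))\<^sup>2)"
  proof (rule integral_less_AE_space)
    show "AE s in M. 0 < (cmod (1 / (z - of_real s)))\<^sup>2"
      using cauchy_kernel_nonzero[OF assms] by auto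
    show "emeasure M (space M) \<noteq> 0" unfolding emeasure_space_1 by simp
  qed (use integrable_cauchy_kernel_sq[OF assms] in auto)
  then show ?thesis unfolding Im_cauchy_transform[OF assms] using assms by simp
qed

lemma integral_affine_combination:
  fixes f g :: "real \<Rightarrow> real"
  assumes "integrable M f" "integrable M g"
  shows "(LINT s|M. f s - c * g s + d) = (LINT s|M. f s) - c * (LINT s|M. g s) + d"
  using assms by simp

text \<open>The variance of 1 / (z - s) under M is nonnegative. Combined with
  \<open>Im_cauchy_transform\<close> this is what makes Im (F z) \<ge> Im z.\<close>

lemma cauchy_transform_sq_le:
  assumes "Im z > 0"
  shows "(cmod (cauchy_transform M z))\<^sup>2 \<le> (LINT s|M. (cmod (1 / (z - of_real s)))\<^sup>2)"
proof -
  define G where "G = cauchy_transform M z"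
  have i: "integrable M (\<lambda>s. Re (cnj G * (1 / (z - of_real s))))"
    by (intro integrable_bounded_linear[OF bounded_linear_Re] integrable_mult_right integrable_cauchy_kernel assms)
  have "(LINT s|M. Re (cnj G * (1 / (z - of_real s)))) = Re (LINT s|M. cnj G * (1 / (z - of_real s)))"
    by (intro integral_bounded_linear[OF bounded_linear_Re] integrable_mult_right integrable_cauchy_kernel assms)
  also have "(LINT s|M. cnj G * (1 / (z - of_real s))) = cnj G * G"
    unfolding G_def cauchy_transform_def by (rule integral_mult_right_zero)
  also have "Re \<dots> = (cmod G)\<^sup>2" by (simp add: cmod_power2 flip: power2_eq_square)
  finally have m: "(LINT s|M. Re (cnj G * (1 / (z - of_real s)))) = (cmod G)\<^sup>2" .
  have "0 \<le> (LINT s|M. (cmod (1 / (z - of_real s) - G))\<^sup>2)" by simp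
  also have "\<dots> = (LINT s|M. ((cmod (1 / (z - of_real s)))\<^sup>2 - 2 * Re (cnj G * (1 / (z - of_real s)))) + (cmod G)\<^sup>2)"
  proof (rule Bochner_Integration.integral_cong[OF refl])
    fix s
    show "(cmod (1 / (z - of_real s) - G))\<^sup>2 =
       ((cmod (1 / (z - of_real s)))\<^sup>2 - 2 * Re (cnj G * (1 / (z - of_real s)))) + (cmod G)\<^sup>2"
      unfolding cmod_power2 minus_complex.sel times_complex.sel
      by (simp add: power2_eq_square algebra_simps)
  qed
  also have "\<dots> = (LINT s|M. (cmod (1 / (z - of_real s)))\<^sup>2) - 2 * (cmod G)\<^sup>2 + (cmod G)\<^sup>2"
    unfolding integral_affine_combination[OF integrable_cauchy_kernel_sq[OF assms] i] m ..
  finally show ?thesis unfolding G_def by simp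
qed

text \<open>Dominated convergence: for y > 0 the integrand is 1 / (1 + i s / y), of modulus at most
  1 and tending to 1.\<close>

lemma cauchy_transform_asymptotics:
  "((\<lambda>y. \<i> * of_real y * cauchy_transform M (\<i> * of_real y)) \<longlongrightarrow> 1) at_top"
proof -
  have "((\<lambda>y. LINT s|M. \<i> * of_real y * (1 / (\<i> * of_real y - of_real s))) \<longlongrightarrow> (LINT s|M. 1)) at_top"
  proof (rule integral_dominated_convergence_at_top[where w = "\<lambda>_. 1"])
    have nz: "\<i> * of_real y - complex_of_real s \<noteq> 0" if "y > 0" for y s
      using cauchy_kernel_nonzero[of "\<i> * of_real y" s] that by simp
    show "AE s in M. ((\<lambda>y. \<i> * of_real y * (1 / (\<i> * of_real y - of_real s))) \<longlongrightarrow> 1) at_top"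
    proof (intro AE_I2)
      fix s :: real
      have "((\<lambda>y. s / y) \<longlongrightarrow> 0) at_top"
        by (rule tendsto_divide_0[OF tendsto_const filterlim_at_top_imp_at_infinity[OF filterlim_ident]])
      then have "((\<lambda>y. 1 / (1 + \<i> * of_real (s / y))) \<longlongrightarrow> 1 / (1 + \<i> * of_real 0)) at_top"
        by (intro tendsto_intros) auto
      moreover have "\<forall>\<^sub>F y in at_top. 1 / (1 + \<i> * of_real (s / y)) = \<i> * of_real y * (1 / (\<i> * of_real y - of_real s))"
        using eventually_gt_at_top[of 0]
      proof eventually_elim
        case (elim y)
        have "\<i> * of_real y - of_real s = \<i> * of_real y * (1 + \<i> * of_real (s / y))"
          using elim by (simp add: complex_eq_iff)
        then show ?case using elim by simp
      qed
      ultimately have "((\<lambda>y. \<i> * of_real y * (1 / (\<i> * of_real y - of_real s)))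
          \<longlongrightarrow> 1 / (1 + \<i> * of_real 0)) at_top"
        by (rule Lim_transform_eventually)
      then show "((\<lambda>y. \<i> * of_real y * (1 / (\<i> * of_real y - of_real s))) \<longlongrightarrow> 1) at_top"
        by simp
    qed
    show "\<forall>\<^sub>F y in at_top. AE s in M. norm (\<i> * of_real y * (1 / (\<i> * of_real y - of_real s))) \<le> 1"
      using eventually_gt_at_top[of 0]
    proof eventually_elim
      case (elim y)
      have "norm (\<i> * of_real y * (1 / (\<i> * of_real y - of_real s))) \<le> 1" for s
      proof -
        have "norm (\<i> * of_real y * (1 / (\<i> * of_real y - of_real s))) = y * cmod (1 / (\<i> * of_real y - of_real s))"
          unfolding norm_mult using elim by simp
        also have "\<dots> \<le> y * (1 / y)"
          using cauchy_kernel_bound[of "\<i> * of_real y" s] elim by (intro mult_left_mono) auto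
        finally show ?thesis using elim by simp
      qed
      then show ?case by simp
    qed
    show "(\<lambda>s. \<i> * of_real y * (1 / (\<i> * of_real y - of_real s))) \<in> borel_measurable M" for y
      by simp
  qed auto
  then show ?thesis
    unfolding integral_mult_right_zero cauchy_transform_def[symmetric] by simp
qed

text \<open>Since F = 1 / G, Im (F z) = - Im (G z) / |G z|^2, which the variance inequality bounds
  below by Im z.\<close>

lemma nevanlinna_recip_cauchy: "nevanlinna (\<lambda>z. recip_cauchy M z - z)"
  unfolding nevanlinna_def
proof (intro conjI allI impI)
  have nz: "cauchy_transform M z \<noteq> 0" if "Im z > 0" for z
    using Im_cauchy_transform_neg[OF that] by auto
  show "(\<lambda>z. recip_cauchy M z - z) holomorphic_on upper_half_plane"
    unfolding recip_cauchy_def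
    by (intro holomorphic_intros cauchy_transform_holomorphic) (use nz in auto)
  show "Im (recip_cauchy M z - z) \<ge> 0" if "Im z > 0" for z
  proof -
    define G where "G = cauchy_transform M z"
    have G: "G \<noteq> 0" using nz[OF that] by (simp add: G_def)
    have "Im z * (cmod G)\<^sup>2 \<le> - Im G"
      using cauchy_transform_sq_le[OF that] Im_cauchy_transform[OF that] that
      by (simp add: G_def mult_left_mono)
    then have "Im z \<le> - Im G / (cmod G)\<^sup>2" using G by (simp add: field_simps)
    also have "\<dots> = Im (1 / G)" by (simp add: Im_divide cmod_power2)
    finally show ?thesis unfolding recip_cauchy_def G_def by simp
  qed
  have "((\<lambda>y. \<i> / (\<i> * of_real y * cauchy_transform M (\<i> * of_real y)) - \<i>) \<longlongrightarrow> \<i> / 1 - \<i>) at_top"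
    by (intro tendsto_intros cauchy_transform_asymptotics) auto
  moreover have "\<forall>\<^sub>F y in at_top. \<i> / (\<i> * of_real y * cauchy_transform M (\<i> * of_real y)) - \<i> =
      (recip_cauchy M (\<i> * of_real y) - \<i> * of_real y) / of_real y"
    using eventually_gt_at_top[of 0]
    by eventually_elim (auto simp: recip_cauchy_def diff_divide_distrib)
  ultimately have "((\<lambda>y. (recip_cauchy M (\<i> * of_real y) - \<i> * of_real y) / of_real y) \<longlongrightarrow> \<i> / 1 - \<i>) at_top"
    by (rule Lim_transform_eventually)
  then show "((\<lambda>y. (recip_cauchy M (\<i> * of_real y) - \<i> * of_real y) / of_real y) \<longlongrightarrow> 0) at_top"
    by simp
qed

end

section \<open>Stieltjes inversion: the Cauchy transform determines the measure\<close>

lemma arctan_diff_le: "\<bar>arctan x - arctan y\<bar> \<le> \<bar>x - y\<bar>"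
proof -
  have "norm (arctan x - arctan y) \<le> 1 * norm (x - y)"
  proof (rule field_differentiable_bound[where S = UNIV and f' = "\<lambda>x. inverse (1 + x\<^sup>2)"])
    show "(arctan has_field_derivative inverse (1 + u\<^sup>2)) (at u within UNIV)" for u
      using DERIV_arctan[of u] by simp
    show "norm (inverse (1 + u\<^sup>2)) \<le> 1" for u :: real
      by (simp add: inverse_le_1_iff add_nonneg_eq_0_iff)
  qed auto
  then show ?thesis by simp
qed

lemma abs_arctan_bounded: "\<bar>arctan x\<bar> \<le> pi / 2"
  using arctan_lbound[of x] arctan_ubound[of x] by linarith

lemma tendsto_arctan_sgn: "(\<lambda>n. arctan (x * real n)) \<longlonglongrightarrow> sgn x * (pi / 2)"
proof -
  have pos: "(\<lambda>n. arctan (c * real n)) \<longlonglongrightarrow> pi / 2" if "c > 0" for c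
    by (rule filterlim_compose[OF tendsto_arctan_at_top])
       (rule filterlim_tendsto_pos_mult_at_top[OF tendsto_const that filterlim_real_sequentially])
  consider "x > 0" | "x = 0" | "x < 0" by linarith
  then show ?thesis
  proof cases
    case 3
    then have "(\<lambda>n. - arctan (- x * real n)) \<longlonglongrightarrow> - (pi / 2)"
      by (intro tendsto_minus pos) simp
    then show ?thesis using 3 by (simp add: arctan_minus)
  qed (use pos in auto)
qed

context real_distribution
begin

text \<open>\<open>- Im (cauchy_transform M (Complex b \<epsilon>))\<close> is pi times the density
  of M smoothed by a Cauchy law of scale \<epsilon>. Working with its antiderivative in b turns
  inversion into a comparison of functions with equal derivatives, without an integral over
  b.\<close>

lemma has_derivative_integral_arctan:
  assumes "\<epsilon> > 0"
  shows "((\<lambda>b. LINT s|M. arctan ((b - s) / \<epsilon>)) has_real_derivative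
     - Im (cauchy_transform M (Complex b \<epsilon>))) (at b)"
proof -
  define k where "k = (\<lambda>s. \<epsilon> * (cmod (1 / (Complex b \<epsilon> - of_real s)))\<^sup>2)"
  have int: "integrable M (\<lambda>s. arctan ((c - s) / \<epsilon>))" for c
  proof (rule integrable_bounded_continuous)
    show "norm (arctan ((c - s) / \<epsilon>)) \<le> pi / 2" for s
      using abs_arctan_bounded by simp
  qed (intro continuous_intros, use assms in auto)
  have pt: "((\<lambda>b. arctan ((b - s) / \<epsilon>)) has_real_derivative k s) (at b)" for s
  proof -
    have "k s = inverse (1 + ((b - s) / \<epsilon>)\<^sup>2) * (1 / \<epsilon>)"
      unfolding k_def norm_divide power_divide cmod_power2 using assms
      by (simp add: field_simps power2_eq_square)
    moreover have "((\<lambda>b. arctan ((b - s) / \<epsilon>)) has_real_derivative inverse (1 + ((b - s) / \<epsilon>)\<^sup>2) * (1 / \<epsilon>)) (at b)"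
      by (rule DERIV_chain2[OF DERIV_arctan]) (use assms in \<open>auto intro!: derivative_eq_intros\<close>)
    ultimately show ?thesis by simp
  qed
  have k: "(LINT s|M. k s) = - Im (cauchy_transform M (Complex b \<epsilon>))"
    using Im_cauchy_transform[of "Complex b \<epsilon>"] assms by (simp add: k_def)
  have "((\<lambda>c. ((LINT s|M. arctan ((c - s) / \<epsilon>)) - (LINT s|M. arctan ((b - s) / \<epsilon>))) / (c - b))
      \<longlongrightarrow> (LINT s|M. k s)) (at b)"
    unfolding tendsto_at_iff_sequentially o_def
  proof (intro allI impI)
    fix X :: "nat \<Rightarrow> real" assume X: "\<forall>i. X i \<in> UNIV - {b}" "X \<longlonglongrightarrow> b"
    have "(\<lambda>i. LINT s|M. (arctan ((X i - s) / \<epsilon>) - arctan ((b - s) / \<epsilon>)) / (X i - b)) \<longlonglongrightarrow> (LINT s|M. k s)"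
    proof (rule integral_dominated_convergence[where w = "\<lambda>_. 1 / \<epsilon>"])
      have k_cont: "continuous_on UNIV k"
        unfolding k_def by (intro continuous_intros) (use assms in \<open>auto simp: complex_eq_iff\<close>)
      show "k \<in> borel_measurable M"
        using borel_measurable_continuous_onI[OF k_cont] by simp
      show "(\<lambda>s. (arctan ((X i - s) / \<epsilon>) - arctan ((b - s) / \<epsilon>)) / (X i - b)) \<in> borel_measurable M" for i
        by measurable
      show "AE s in M. (\<lambda>i. (arctan ((X i - s) / \<epsilon>) - arctan ((b - s) / \<epsilon>)) / (X i - b)) \<longlonglongrightarrow> k s"
      proof (rule AE_I2)
        fix s
        have "((\<lambda>c. (arctan ((c - s) / \<epsilon>) - arctan ((b - s) / \<epsilon>)) / (c - b)) \<longlongrightarrow> k s) (at b)"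
          using pt[of s] unfolding has_field_derivative_iff .
        then show "(\<lambda>i. (arctan ((X i - s) / \<epsilon>) - arctan ((b - s) / \<epsilon>)) / (X i - b)) \<longlonglongrightarrow> k s"
          using X unfolding tendsto_at_iff_sequentially o_def by auto
      qed
      show "AE s in M. norm ((arctan ((X i - s) / \<epsilon>) - arctan ((b - s) / \<epsilon>)) / (X i - b)) \<le> 1 / \<epsilon>" for i
      proof (rule AE_I2)
        fix s
        have ne: "\<bar>X i - b\<bar> > 0" using X by auto
        have "\<bar>arctan ((X i - s) / \<epsilon>) - arctan ((b - s) / \<epsilon>)\<bar> \<le> \<bar>(X i - s) / \<epsilon> - (b - s) / \<epsilon>\<bar>"
          by (rule arctan_diff_le)
        also have "\<dots> = \<bar>X i - b\<bar> / \<epsilon>"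
          unfolding diff_divide_distrib[symmetric] using assms by simp
        finally show "norm ((arctan ((X i - s) / \<epsilon>) - arctan ((b - s) / \<epsilon>)) / (X i - b)) \<le> 1 / \<epsilon>"
          using ne by (simp add: field_simps)
      qed
    qed simp
    then show "(\<lambda>i. ((LINT s|M. arctan ((X i - s) / \<epsilon>)) - (LINT s|M. arctan ((b - s) / \<epsilon>))) / (X i - b))
        \<longlonglongrightarrow> (LINT s|M. k s)"
      using int by simp
  qed
  then show ?thesis unfolding has_field_derivative_iff k .
qed

text \<open>Fixes the constant of integration: antiderivatives with equal derivatives and this
  common limit coincide.\<close>

lemma integral_arctan_at_top:
  assumes "\<epsilon> > 0"
  shows "((\<lambda>b. LINT s|M. arctan ((b - s) / \<epsilon>)) \<longlongrightarrow> pi / 2) at_top"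
proof -
  have "((\<lambda>b. LINT s|M. arctan ((b - s) / \<epsilon>)) \<longlongrightarrow> (LINT s|M. pi / 2)) at_top"
  proof (rule integral_dominated_convergence_at_top[where w = "\<lambda>_. pi / 2"])
    show "AE s in M. ((\<lambda>b. arctan ((b - s) / \<epsilon>)) \<longlongrightarrow> pi / 2) at_top"
    proof (rule AE_I2)
      fix s
      have "filterlim (\<lambda>b. (1 / \<epsilon>) * (- s + b)) at_top at_top"
        by (intro filterlim_tendsto_pos_mult_at_top[OF tendsto_const]
            filterlim_tendsto_add_at_top[OF tendsto_const] filterlim_ident) (use assms in simp)
      then have "filterlim (\<lambda>b. (b - s) / \<epsilon>) at_top at_top" by simp
      then show "((\<lambda>b. arctan ((b - s) / \<epsilon>)) \<longlongrightarrow> pi / 2) at_top"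
        by (rule filterlim_compose[OF tendsto_arctan_at_top])
    qed
    show "\<forall>\<^sub>F b in at_top. AE s in M. norm (arctan ((b - s) / \<epsilon>)) \<le> pi / 2"
    proof (intro always_eventually allI AE_I2)
      show "norm (arctan ((b - s) / \<epsilon>)) \<le> pi / 2" for b s
        using abs_arctan_bounded by simp
    qed
  qed auto
  then show ?thesis by (simp add: prob_space)
qed

text \<open>The scale \<epsilon> = 1 / n tends to 0. The limit sgn vanishes at s = b, so an atom at
  b is counted half.\<close>

lemma integral_arctan_tendsto_sgn:
  "(\<lambda>n. LINT s|M. arctan ((b - s) * real n)) \<longlonglongrightarrow> pi / 2 * (LINT s|M. sgn (b - s))"
proof -
  have "(\<lambda>n. LINT s|M. arctan ((b - s) * real n)) \<longlonglongrightarrow> (LINT s|M. sgn (b - s) * (pi / 2))"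
  proof (rule integral_dominated_convergence[where w = "\<lambda>_. pi / 2"])
    show "AE s in M. (\<lambda>n. arctan ((b - s) * real n)) \<longlonglongrightarrow> sgn (b - s) * (pi / 2)"
      by (rule AE_I2) (rule tendsto_arctan_sgn)
    show "AE s in M. norm (arctan ((b - s) * real n)) \<le> pi / 2" for n
    proof (rule AE_I2)
      show "norm (arctan ((b - s) * real n)) \<le> pi / 2" for s
        using abs_arctan_bounded by simp
    qed
  qed auto
  then show ?thesis by (simp add: mult.commute)
qed

text \<open>Approaching b strictly from the right puts an atom at b on the side where sgn is 1,
  which repairs the half count and produces the right-continuous distribution function.\<close>

lemma integral_sgn_tendsto_cdf:
  "(\<lambda>n. LINT s|M. sgn (b + 1 / real (Suc n) - s)) \<longlonglongrightarrow> 2 * cdf M b - 1"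
proof -
  have "(\<lambda>n. LINT s|M. sgn (b + 1 / real (Suc n) - s)) \<longlonglongrightarrow> (LINT s|M. 2 * indicator {..b} s - 1)"
  proof (rule integral_dominated_convergence[where w = "\<lambda>_. 1"])
    show "AE s in M. (\<lambda>n. sgn (b + 1 / real (Suc n) - s)) \<longlonglongrightarrow> 2 * indicator {..b} s - 1"
    proof (rule AE_I2)
      fix s
      show "(\<lambda>n. sgn (b + 1 / real (Suc n) - s)) \<longlonglongrightarrow> 2 * indicator {..b} s - 1"
      proof (cases "s \<le> b")
        case True
        have "sgn (b + 1 / real (Suc n) - s) = 1" for n
        proof -
          have "1 / real (Suc n) > 0" by simp
          then have "b + 1 / real (Suc n) - s > 0" using True by linarith
          then show ?thesis by simp
        qed
        then show ?thesis using True by simp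
      next
        case False
        have "(\<lambda>n. b + 1 / real (Suc n) - s) \<longlonglongrightarrow> b + 0 - s"
          using LIMSEQ_inverse_real_of_nat by (intro tendsto_intros) (simp add: inverse_eq_divide)
        then have "\<forall>\<^sub>F n in sequentially. b + 1 / real (Suc n) - s < 0"
          using False by (intro order_tendstoD) auto
        then have "\<forall>\<^sub>F n in sequentially. sgn (b + 1 / real (Suc n) - s) = -1"
          by eventually_elim simp
        then show ?thesis using False by (simp add: tendsto_eventually)
      qed
    qed
    show "AE s in M. norm (sgn (b + 1 / real (Suc n) - s)) \<le> 1" for n
      by (rule AE_I2) (simp add: sgn_real_def)
  qed auto
  also have "(LINT s|M. 2 * indicator {..b} s - 1) = 2 * cdf M b - 1"
  proof -
    have "integrable M (indicator {..b} :: real \<Rightarrow> real)" by (simp add: emeasure_eq_measure)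
    then show ?thesis by (simp add: cdf_def)
  qed
  finally show ?thesis .
qed

end

text \<open>Equal transforms give equal derivatives in b of the arctan averages; hence these
  averages, then the sign averages, then the distribution functions agree.\<close>

proposition cauchy_transform_unique:
  assumes "real_distribution M" "real_distribution N"
    and eq: "\<And>z. Im z > 0 \<Longrightarrow> cauchy_transform M z = cauchy_transform N z"
  shows "M = N"
proof -
  interpret M: real_distribution M by fact
  interpret N: real_distribution N by fact
  have A: "(LINT s|M. arctan ((b - s) / \<epsilon>)) = (LINT s|N. arctan ((b - s) / \<epsilon>))" if e: "\<epsilon> > 0" for b \<epsilon>
  proof -
    define d where "d = (\<lambda>b. (LINT s|M. arctan ((b - s) / \<epsilon>)) - (LINT s|N. arctan ((b - s) / \<epsilon>)))"
    have "(d has_real_derivative 0) (at b)" for b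
      using DERIV_diff[OF M.has_derivative_integral_arctan[OF e, of b] N.has_derivative_integral_arctan[OF e, of b]]
      unfolding d_def using eq[of "Complex b \<epsilon>"] e by simp
    then have const: "d x = d y" for x y by (intro DERIV_isconst_all) auto
    have "(d \<longlongrightarrow> pi / 2 - pi / 2) at_top"
      unfolding d_def by (intro tendsto_diff M.integral_arctan_at_top N.integral_arctan_at_top e)
    moreover have "(d \<longlongrightarrow> d b) at_top"
      using const by (intro tendsto_eventually always_eventually) auto
    ultimately have "d b = pi / 2 - pi / 2" by (intro tendsto_unique[of at_top]) auto
    then show ?thesis by (simp add: d_def)
  qed
  \<comment> \<open>For n = 0 both integrands are arctan 0 = 0; otherwise the scale is 1 /
    n.\<close>
  have "(LINT s|M. arctan ((b - s) * real n)) = (LINT s|N. arctan ((b - s) * real n))" for b n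
    using A[of "1 / real n" b] by (cases "n = 0") auto
  then have "(\<lambda>n. LINT s|M. arctan ((b - s) * real n)) \<longlonglongrightarrow> pi / 2 * (LINT s|N. sgn (b - s))" for b
    using N.integral_arctan_tendsto_sgn by simp
  then have "pi / 2 * (LINT s|M. sgn (b - s)) = pi / 2 * (LINT s|N. sgn (b - s))" for b
    using M.integral_arctan_tendsto_sgn LIMSEQ_unique by blast
  then have "(LINT s|M. sgn (b - s)) = (LINT s|N. sgn (b - s))" for b by simp
  then have "(\<lambda>n. LINT s|M. sgn (b + 1 / real (Suc n) - s)) \<longlonglongrightarrow> 2 * cdf N b - 1" for b
    using N.integral_sgn_tendsto_cdf by simp
  then have "2 * cdf M b - 1 = 2 * cdf N b - 1" for b
    using M.integral_sgn_tendsto_cdf LIMSEQ_unique by blast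
  then have "cdf M = cdf N" by auto
  then show ?thesis by (intro cdf_unique assms)
qed

section \<open>The Nevanlinna representation\<close>

text \<open>Written through the squared Cauchy kernel so that \<open>Im_cauchy_transform\<close> is
  visibly a Poisson integral.\<close>

definition poisson_kernel :: "complex \<Rightarrow> real \<Rightarrow> real" where
  "poisson_kernel z x = Im z * (cmod (1 / (z - of_real x)))\<^sup>2 / pi"

lemma poisson_kernel_eq:
  assumes "Im z > 0"
  shows "complex_of_real (poisson_kernel z x) = of_real (Im z / pi) / ((of_real x - z) * (of_real x - cnj z))"
proof -
  have "(of_real x - z) * (of_real x - cnj z) = of_real ((cmod (z - of_real x))\<^sup>2)"
    unfolding complex_norm_square by (simp add: algebra_simps)
  then show ?thesis by (simp add: poisson_kernel_def norm_divide power_divide)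
qed

lemma has_bochner_integral_poisson_kernel:
  assumes "Im z > 0"
  shows "has_bochner_integral lborel (poisson_kernel z) 1"
proof -
  have "integrable lborel (\<lambda>x::real. inverse (1 + x\<^sup>2))"
    using integrable_inverse_1_plus_square by (simp add: set_integrable_def)
  moreover have "(LINT x|lborel. inverse (1 + x\<^sup>2)) = pi"
    using LBINT_inverse_1_plus_square
    by (simp add: interval_lebesgue_integral_def set_lebesgue_integral_def)
  ultimately have "has_bochner_integral lborel (\<lambda>x::real. inverse (1 + x\<^sup>2)) pi"
    by (simp add: has_bochner_integral_iff)
  then have "has_bochner_integral lborel (\<lambda>x. inverse (1 + (- Re z / Im z + 1 / Im z * x)\<^sup>2)) (pi /\<^sub>R \<bar>1 / Im z\<bar>)"
    using assms by (subst (asm) lborel_has_bochner_integral_real_affine_iff[of "1 / Im z" _ _ "- Re z / Im z"]) auto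
  then have "has_bochner_integral lborel (\<lambda>x. 1 / (pi * Im z) * inverse (1 + (- Re z / Im z + 1 / Im z * x)\<^sup>2))
      (1 / (pi * Im z) * (pi /\<^sub>R \<bar>1 / Im z\<bar>))"
    by (rule has_bochner_integral_mult_right)
  moreover have "1 / (pi * Im z) * inverse (1 + (- Re z / Im z + 1 / Im z * x)\<^sup>2) = poisson_kernel z x" for x
  proof -
    have "1 + (- Re z / Im z + 1 / Im z * x)\<^sup>2 = ((Re z - x)\<^sup>2 + (Im z)\<^sup>2) / (Im z)\<^sup>2"
      using assms by (simp add: field_simps power2_eq_square)
    moreover have "(cmod (z - of_real x))\<^sup>2 = (Re z - x)\<^sup>2 + (Im z)\<^sup>2" by (simp add: cmod_power2)
    ultimately show ?thesis using assms
      by (simp add: poisson_kernel_def norm_divide power_divide power2_eq_square)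
  qed
  moreover have "1 / (pi * Im z) * (pi /\<^sub>R \<bar>1 / Im z\<bar>) = 1" using assms by simp
  ultimately show ?thesis by simp
qed

text \<open>Subtracting h z removes the pole at z, and the other pole cnj z lies below the domain,
  so Cauchy's theorem applies to the segment closed by a half circle. Boundedness of h makes the arc
  contribution of order R / R^2.\<close>

lemma integral_semicircle_tendsto_0:
  assumes holh: "h holomorphic_on {w. Im w > - \<epsilon>}" and \<epsilon>: "\<epsilon> > 0"
    and B: "\<And>w. Im w \<ge> 0 \<Longrightarrow> cmod (h w) \<le> B" and z: "Im z > 0"
  shows "((\<lambda>R. integral {- R..R} (\<lambda>x. (h (of_real x) - h z) / ((of_real x - z) * (of_real x - cnj z)))) \<longlongrightarrow> 0) at_top"
proof -
  \<comment> \<open>A margin small enough for S to lie in the domain of h and to exclude cnj z,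
    whose imaginary part is - Im z.\<close>
  define \<eta> where "\<eta> = min \<epsilon> (Im z)"
  have \<eta>: "\<eta> > 0" "\<eta> \<le> \<epsilon>" "\<eta> \<le> Im z" unfolding \<eta>_def using \<epsilon> z by auto
  define S where "S = {w. Im w > - \<eta>}"
  have openS: "open S" unfolding S_def by (rule open_halfspace_Im_gt)
  have convS: "convex S" unfolding S_def by (rule convex_halfspace_Im_gt)
  have holhS: "h holomorphic_on S"
    using holh by (rule holomorphic_on_subset) (use \<eta> in \<open>auto simp: S_def\<close>)
  \<comment> \<open>The value \<open>deriv h z\<close> at z fills the removable singularity; on the
    real line this branch is never met.\<close>
  define Q where "Q = (\<lambda>w. (if w = z then deriv h z else (h w - h z) / (w - z)) / (w - cnj z))"
  have nz: "w - cnj z \<noteq> 0" if "w \<in> S" for w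
    using that \<eta> by (auto simp: S_def complex_eq_iff)
  have holQ: "Q holomorphic_on S"
    unfolding Q_def by (intro holomorphic_on_divide pole_lemma_open holhS openS holomorphic_intros nz)
  have Qreal: "Q (of_real x) = (h (of_real x) - h z) / ((of_real x - z) * (of_real x - cnj z))" for x
    using z by (auto simp: Q_def complex_eq_iff)
  have B0: "B \<ge> 0" using order_trans[OF norm_ge_zero B[of 0]] by simp
  have bound: "cmod (integral {- R..R} (\<lambda>x. Q (of_real x))) \<le> 2 * B / (R - cmod z)\<^sup>2 * R * \<bar>pi - 0\<bar>"
    if R: "R > cmod z" for R
  proof -
    have R0: "R > 0" using R norm_ge_zero[of z] by linarith
    define L where "L = linepath (complex_of_real (- R)) (of_real R)"
    define C where "C = part_circlepath 0 R 0 pi"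
    have arc: "Im w \<ge> 0 \<and> cmod w = R" if "w \<in> path_image C" for w
    proof -
      from that obtain \<theta> where \<theta>: "w = of_real R * cis \<theta>" "\<theta> \<in> closed_segment 0 pi"
        unfolding C_def path_image_part_circlepath' by auto
      then have "0 \<le> \<theta>" "\<theta> \<le> pi" by (auto simp: closed_segment_eq_real_ivl)
      then show ?thesis using R0 \<theta>(1) by (simp add: sin_ge_zero norm_mult)
    qed
    have subC: "path_image C \<subseteq> S" using arc \<eta> by (force simp: S_def)
    have subL: "path_image L \<subseteq> S"
    proof
      fix w assume "w \<in> path_image L"
      then have "w \<in> closed_segment (complex_of_real (- R)) (of_real R)" by (simp add: L_def)
      then have "Im w = 0" by (auto simp: closed_segment_def)
      then show "w \<in> S" using \<eta> by (simp add: S_def)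
    qed
    have contQ: "continuous_on S Q" using holQ by (rule holomorphic_on_imp_continuous_on)
    have iL: "Q contour_integrable_on L"
      unfolding L_def by (rule contour_integrable_continuous_linepath)
        (use subL contQ in \<open>auto simp: L_def intro: continuous_on_subset\<close>)
    have iC: "Q contour_integrable_on C"
      unfolding C_def by (rule contour_integrable_continuous_part_circlepath)
        (use subC contQ in \<open>auto simp: C_def intro: continuous_on_subset\<close>)
    have join: "pathfinish L = pathstart C" "pathfinish C = pathstart L"
      by (auto simp: L_def C_def)
    have vp: "valid_path L" "valid_path C" by (auto simp: L_def C_def)
    have "(Q has_contour_integral 0) (L +++ C)"
      by (rule Cauchy_theorem_convex_simple[OF holQ convS])
         (use vp join subL subC in \<open>auto simp: path_image_join valid_path_join\<close>)
    then have "contour_integral L Q + contour_integral C Q = 0"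
      using contour_integral_join[OF iL iC vp] contour_integral_unique by metis
    then have eq: "contour_integral L Q = - contour_integral C Q" by (simp add: add_eq_0_iff2)
    have "contour_integral L Q = integral {- R..R} (\<lambda>x. Q (of_real x))"
      unfolding L_def using R0 by (subst contour_integral_linepath_Reals_eq) auto
    then have "cmod (integral {- R..R} (\<lambda>x. Q (of_real x))) = cmod (contour_integral C Q)"
      using eq by (metis norm_minus_cancel)
    also have "\<dots> \<le> 2 * B / (R - cmod z)\<^sup>2 * R * \<bar>pi - 0\<bar>"
      unfolding C_def
    proof (rule contour_integral_bound_part_circlepath)
      fix w assume "w \<in> path_image (part_circlepath 0 R 0 pi)"
      then have w: "Im w \<ge> 0" "cmod w = R" using arc by (auto simp: C_def)
      have "w \<noteq> z" using w R by auto
      then have "cmod (Q w) = cmod (h w - h z) / (cmod (w - z) * cmod (w - cnj z))"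
        by (simp add: Q_def norm_divide norm_mult)
      also have "\<dots> \<le> (2 * B) / ((R - cmod z) * (R - cmod z))"
      proof (rule frac_le)
        show "cmod (h w - h z) \<le> 2 * B"
          using norm_triangle_ineq4[of "h w" "h z"] B[OF w(1)] B[of z] z by simp
        show "(R - cmod z) * (R - cmod z) \<le> cmod (w - z) * cmod (w - cnj z)"
          using norm_triangle_ineq2[of w z] norm_triangle_ineq2[of w "cnj z"] w R
          by (intro mult_mono) auto
      qed (use B0 R in auto)
      finally show "cmod (Q w) \<le> 2 * B / (R - cmod z)\<^sup>2" by (simp add: power2_eq_square)
    qed (use iC R0 B0 in \<open>auto simp: C_def\<close>)
    finally show ?thesis .
  qed
  have "((\<lambda>R. integral {- R..R} (\<lambda>x. Q (of_real x))) \<longlongrightarrow> 0) at_top"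
  proof (rule Lim_null_comparison)
    show "\<forall>\<^sub>F R in at_top. cmod (integral {- R..R} (\<lambda>x. Q (of_real x))) \<le> 2 * B / (R - cmod z)\<^sup>2 * R * \<bar>pi - 0\<bar>"
      using eventually_gt_at_top[of "cmod z"] by eventually_elim (rule bound)
    show "((\<lambda>R. 2 * B / (R - cmod z)\<^sup>2 * R * \<bar>pi - 0\<bar>) \<longlongrightarrow> 0) at_top"
      by real_asymp
  qed
  then show ?thesis unfolding Qreal .
qed

text \<open>Split h (of_real x) as (h (of_real x) - h z) + h z: against the Poisson kernel the first
  part integrates to 0 by the contour estimate, the second to h z since the kernel has mass
  1.\<close>

lemma poisson_integral_half_plane:
  assumes holh: "h holomorphic_on {w. Im w > - \<epsilon>}" and \<epsilon>: "\<epsilon> > 0"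
    and B: "\<And>w. Im w \<ge> 0 \<Longrightarrow> cmod (h w) \<le> B" and z: "Im z > 0"
  shows "has_bochner_integral lborel (\<lambda>x. h (of_real x) * of_real (poisson_kernel z x)) (h z)"
proof -
  define q where "q = (\<lambda>x. (h (of_real x) - h z) * of_real (poisson_kernel z x))"
  define p where "p = (\<lambda>x. (h (of_real x) - h z) / ((of_real x - z) * (of_real x - cnj z)))"
  have qp: "q x = of_real (Im z / pi) * p x" for x
    unfolding q_def p_def poisson_kernel_eq[OF z] by simp
  have P: "integrable lborel (poisson_kernel z)" "(LINT x|lborel. poisson_kernel z x) = 1"
    using has_bochner_integral_poisson_kernel[OF z] by (auto simp: has_bochner_integral_iff)
  have P0: "poisson_kernel z x \<ge> 0" for x using z by (simp add: poisson_kernel_def)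
  have contq: "continuous_on UNIV q"
  proof -
    have "continuous_on UNIV (\<lambda>x. h (of_real x))"
      by (rule continuous_on_compose2[OF holomorphic_on_imp_continuous_on[OF holh]])
         (use \<epsilon> in \<open>auto intro!: continuous_intros\<close>)
    then show ?thesis unfolding q_def poisson_kernel_def
      by (intro continuous_intros) (use z in \<open>auto simp: complex_eq_iff\<close>)
  qed
  have intq: "integrable lborel q"
  proof (rule Bochner_Integration.integrable_bound)
    show "integrable lborel (\<lambda>x. 2 * B * poisson_kernel z x)" using P by simp
    show "q \<in> borel_measurable lborel"
      using borel_measurable_continuous_onI[OF contq] by simp
    have "cmod (h (of_real x) - h z) \<le> 2 * B" for x
      using norm_triangle_ineq4[of "h (of_real x)" "h z"] B[of "of_real x"] B[of z] z by simp
    then have "norm (q x) \<le> 2 * B * poisson_kernel z x" for x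
      unfolding q_def norm_mult using P0[of x] by (simp add: mult_right_mono)
    then have "norm (q x) \<le> norm (2 * B * poisson_kernel z x)" for x
      using abs_ge_self order_trans unfolding real_norm_def by blast
    then show "AE x in lborel. norm (q x) \<le> norm (2 * B * poisson_kernel z x)" by simp
  qed
  have "((\<lambda>R. LINT x|lborel. indicator {- R..R} x *\<^sub>R q x) \<longlongrightarrow> (LINT x|lborel. q x)) at_top"
  proof (rule integral_dominated_convergence_at_top[where w = "\<lambda>x. norm (q x)"])
    show "AE x in lborel. ((\<lambda>R. indicator {- R..R} x *\<^sub>R q x) \<longlongrightarrow> q x) at_top"
    proof (rule AE_I2)
      fix x :: real
      have "\<forall>\<^sub>F R in at_top. indicator {- R..R} x *\<^sub>R q x = q x"
        using eventually_ge_at_top[of "\<bar>x\<bar>"] by eventually_elim (auto simp: indicator_def)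
      then show "((\<lambda>R. indicator {- R..R} x *\<^sub>R q x) \<longlongrightarrow> q x) at_top" by (rule tendsto_eventually)
    qed
    show "(\<lambda>x. indicator {- R..R} x *\<^sub>R q x) \<in> borel_measurable lborel" for R
      using intq by simp
    show "\<forall>\<^sub>F R in at_top. AE x in lborel. norm (indicator {- R..R} x *\<^sub>R q x) \<le> norm (q x)"
      by (auto simp: indicator_def)
  qed (use intq in auto)
  moreover have "((\<lambda>R. LINT x|lborel. indicator {- R..R} x *\<^sub>R q x) \<longlongrightarrow> 0) at_top"
  proof -
    have "(LINT x|lborel. indicator {- R..R} x *\<^sub>R q x) = of_real (Im z / pi) * integral {- R..R} p" for R
    proof -
      have "set_integrable lborel {- R..R} q"
        unfolding set_integrable_def using integrable_mult_indicator[OF _ intq] by simp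
      then have "(LINT x|lborel. indicator {- R..R} x *\<^sub>R q x) = integral {- R..R} q"
        using set_borel_integral_eq_integral(2) unfolding set_lebesgue_integral_def by blast
      also have "\<dots> = of_real (Im z / pi) * integral {- R..R} p"
        unfolding qp by (rule integral_mult_right)
      finally show ?thesis .
    qed
    moreover have "((\<lambda>R. of_real (Im z / pi) * integral {- R..R} p) \<longlongrightarrow> of_real (Im z / pi) * 0) at_top"
      unfolding p_def by (intro tendsto_intros integral_semicircle_tendsto_0[OF holh \<epsilon> B z])
    ultimately show ?thesis by simp
  qed
  ultimately have q0: "(LINT x|lborel. q x) = 0" by (intro tendsto_unique[of at_top]) auto
  have "has_bochner_integral lborel (\<lambda>x. q x + h z * of_real (poisson_kernel z x)) (0 + h z * of_real 1)"
  proof (intro has_bochner_integral_add has_bochner_integral_mult_right has_bochner_integral_of_real)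
    show "has_bochner_integral lborel q 0" using intq q0 by (simp add: has_bochner_integral_iff)
  qed (use has_bochner_integral_poisson_kernel[OF z] in auto)
  then show ?thesis by (simp add: q_def algebra_simps)
qed

section \<open>Measures with a prescribed Cauchy transform\<close>

lemma constant_zero_of_imaginary_axis:
  assumes "((\<lambda>y. \<i> * of_real y * D (\<i> * of_real y)) \<longlongrightarrow> 0) at_top" "\<And>y. y > 0 \<Longrightarrow> D (\<i> * of_real y) = d"
  shows "d = 0"
proof -
  have "((\<lambda>y. 1 / of_real y * (\<i> * of_real y * D (\<i> * of_real y))) \<longlongrightarrow> (0::complex) * 0) at_top"
  proof (intro tendsto_mult assms(1))
    have "((\<lambda>y. complex_of_real (1 / y)) \<longlongrightarrow> of_real 0) at_top"
      by (intro tendsto_of_real tendsto_divide_0[OF tendsto_const filterlim_at_top_imp_at_infinity[OF filterlim_ident]])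
    then show "((\<lambda>y. 1 / complex_of_real y) \<longlongrightarrow> 0) at_top" by simp
  qed
  moreover have "((\<lambda>y. 1 / of_real y * (\<i> * of_real y * D (\<i> * of_real y))) \<longlongrightarrow> \<i> * d) at_top"
  proof (rule tendsto_eventually)
    show "\<forall>\<^sub>F y in at_top. 1 / of_real y * (\<i> * of_real y * D (\<i> * of_real y)) = \<i> * d"
      using eventually_gt_at_top[of 0] by eventually_elim (simp add: assms(2))
  qed
  ultimately have "\<i> * d = 0 * 0" by (intro tendsto_unique[of at_top]) auto
  then show ?thesis by simp
qed

text \<open>As h extends across the real line, Stieltjes inversion suggests the density - Im h / pi.
  By the Poisson formula its Cauchy transform has the same imaginary part as h; the difference is
  then a real constant, killed by the asymptotics along the imaginary axis.\<close>

lemma cauchy_transform_exists_regular: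
  assumes holh: "h holomorphic_on {w. Im w > - \<epsilon>}" and \<epsilon>: "\<epsilon> > 0"
    and B: "\<And>w. Im w \<ge> 0 \<Longrightarrow> cmod (h w) \<le> B"
    and neg: "\<And>w. Im w \<ge> 0 \<Longrightarrow> Im (h w) \<le> 0"
    and lim: "((\<lambda>y. \<i> * of_real y * h (\<i> * of_real y)) \<longlongrightarrow> 1) at_top"
  obtains N where "real_distribution N" "\<And>z. Im z > 0 \<Longrightarrow> cauchy_transform N z = h z"
proof -
  define \<rho> where "\<rho> = (\<lambda>x. - Im (h (of_real x)) / pi)"
  have \<rho>0: "\<rho> x \<ge> 0" for x unfolding \<rho>_def using neg[of "of_real x"] by (intro divide_nonneg_pos) auto
  have \<rho>P: "has_bochner_integral lborel (\<lambda>x. \<rho> x * (pi * poisson_kernel z x)) (- Im (h z))" if z: "Im z > 0" for z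
  proof -
    have "has_bochner_integral lborel (\<lambda>x. Im (h (of_real x) * of_real (poisson_kernel z x))) (Im (h z))"
      by (rule has_bochner_integral_Im[OF poisson_integral_half_plane[OF holh \<epsilon> B z]])
    then have "has_bochner_integral lborel (\<lambda>x. - Im (h (of_real x) * of_real (poisson_kernel z x))) (- Im (h z))"
      by (rule has_bochner_integral_minus)
    then show ?thesis by (simp add: \<rho>_def)
  qed
  have [measurable]: "\<rho> \<in> borel_measurable borel"
  proof -
    have "continuous_on UNIV (\<lambda>x. h (of_real x))"
      by (rule continuous_on_compose2[OF holomorphic_on_imp_continuous_on[OF holh]])
         (use \<epsilon> in \<open>auto intro!: continuous_intros\<close>)
    then show ?thesis unfolding \<rho>_def by (intro borel_measurable_continuous_onI continuous_intros) auto
  qed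
  \<comment> \<open>Poisson kernels at the points i (n + 1), rescaled to (n + 1)^2 / ((n + 1)^2 +
    x^2), increase to 1. Monotone convergence thus reads the total mass of \<rho> off the limit in
    \<open>lim\<close>.\<close>
  define k where "k = (\<lambda>n x. real (Suc n) * (pi * poisson_kernel (\<i> * of_real (real (Suc n))) x))"
  have k_eq: "k n x = (real (Suc n))\<^sup>2 / ((real (Suc n))\<^sup>2 + x\<^sup>2)" for n x
  proof -
    have "(cmod (\<i> * of_real (real (Suc n)) - of_real x))\<^sup>2 = (real (Suc n))\<^sup>2 + x\<^sup>2"
      by (simp add: cmod_power2)
    then show ?thesis
      unfolding k_def poisson_kernel_def norm_divide power_divide by (simp add: power2_eq_square)
  qed
  have int1: "integrable lborel \<rho>" "(LINT x|lborel. \<rho> x) = 1"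
  proof -
    have I: "has_bochner_integral lborel (\<lambda>x. \<rho> x * k n x) (real (Suc n) * - Im (h (\<i> * of_real (real (Suc n)))))" for n
      using has_bochner_integral_mult_right[OF \<rho>P[of "\<i> * of_real (real (Suc n))"], of "real (Suc n)"]
      by (simp add: k_def mult_ac)
    have m: "AE x in lborel. mono (\<lambda>n. \<rho> x * k n x)"
    proof (rule AE_I2, rule monoI)
      fix x :: real and m n :: nat assume "m \<le> n"
      then have le: "(real (Suc m))\<^sup>2 \<le> (real (Suc n))\<^sup>2" by (intro power_mono) auto
      have "a / (a + x\<^sup>2) \<le> b / (b + x\<^sup>2)" if "0 < a" "a \<le> b" for a b :: real
      proof -
        have "a * x\<^sup>2 \<le> b * x\<^sup>2" using that by (intro mult_right_mono) auto
        moreover have "a + x\<^sup>2 > 0" "b + x\<^sup>2 > 0" using that by (auto intro: add_pos_nonneg)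
        ultimately show ?thesis by (simp add: divide_simps) (simp add: algebra_simps)
      qed
      then have "k m x \<le> k n x" unfolding k_eq using le by simp
      then show "\<rho> x * k m x \<le> \<rho> x * k n x" using \<rho>0 by (rule mult_left_mono)
    qed
    have p: "AE x in lborel. 0 \<le> \<rho> x * k n x" for n
      using \<rho>0 by (simp add: k_eq)
    have l: "AE x in lborel. (\<lambda>n. \<rho> x * k n x) \<longlonglongrightarrow> \<rho> x"
    proof (rule AE_I2)
      fix x :: real
      have "(\<lambda>n. k n x) \<longlonglongrightarrow> 1" unfolding k_eq by real_asymp
      then have "(\<lambda>n. \<rho> x * k n x) \<longlonglongrightarrow> \<rho> x * 1" by (intro tendsto_intros)
      then show "(\<lambda>n. \<rho> x * k n x) \<longlonglongrightarrow> \<rho> x" by simp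
    qed
    have "((\<lambda>y. Re (\<i> * of_real y * h (\<i> * of_real y))) \<longlongrightarrow> Re 1) at_top"
      by (intro tendsto_Re lim)
    then have "((\<lambda>y. y * - Im (h (\<i> * of_real y))) \<longlongrightarrow> 1) at_top" by simp
    moreover have "filterlim (\<lambda>n. real (Suc n)) at_top sequentially"
      by (rule filterlim_compose[OF filterlim_real_sequentially filterlim_Suc])
    ultimately have il: "(\<lambda>n. LINT x|lborel. \<rho> x * k n x) \<longlonglongrightarrow> 1"
      unfolding has_bochner_integral_integral_eq[OF I]
      by (rule filterlim_compose)
    have i: "integrable lborel (\<lambda>x. \<rho> x * k n x)" for n using I by (simp add: has_bochner_integral_iff)
    show "integrable lborel \<rho>" "(LINT x|lborel. \<rho> x) = 1"
      by (rule integral_monotone_convergence_nonneg[OF i m p l il]; simp)+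
  qed
  define N where "N = density lborel (\<lambda>x. ennreal (\<rho> x))"
  have "emeasure N (space N) = 1"
    using int1 \<rho>0 by (simp add: N_def emeasure_density nn_integral_eq_integral)
  then have "prob_space N" by (rule prob_spaceI)
  then have N: "real_distribution N"
    by (auto simp: real_distribution_def real_distribution_axioms_def N_def)
  interpret N: real_distribution N by fact
  define D where "D = (\<lambda>z. h z - cauchy_transform N z)"
  have holD: "D holomorphic_on upper_half_plane"
    unfolding D_def using holh \<epsilon>
    by (intro holomorphic_intros N.cauchy_transform_holomorphic holomorphic_on_subset[OF holh]) auto
  have ImD: "Im (D z) = 0" if z: "Im z > 0" for z
  proof -
    have "(LINT s|N. (cmod (1 / (z - of_real s)))\<^sup>2) = (LINT s|lborel. \<rho> s *\<^sub>R (cmod (1 / (z - of_real s)))\<^sup>2)"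
      unfolding N_def by (rule integral_density) (use \<rho>0 in auto)
    then have "Im (cauchy_transform N z) = - (LINT s|lborel. \<rho> s * (pi * poisson_kernel z s))"
      unfolding N.Im_cauchy_transform[OF z] by (simp add: poisson_kernel_def mult.left_commute del: integral_mult_right_zero flip: integral_mult_right_zero)
    also have "\<dots> = Im (h z)" using has_bochner_integral_integral_eq[OF \<rho>P[OF z]] by simp
    finally show ?thesis by (simp add: D_def)
  qed
  \<comment> \<open>A holomorphic function with vanishing imaginary part is constant: the right-hand
    side of Schwarz-Pick is 0.\<close>
  have const: "D z = D w" if "Im z > 0" "Im w > 0" for z w
    using schwarz_pick[OF holD _ that] ImD that by (simp add: mult_le_0_iff)
  have "D \<i> = 0"
  proof (rule constant_zero_of_imaginary_axis)
    have "((\<lambda>y. \<i> * of_real y * h (\<i> * of_real y) - \<i> * of_real y * cauchy_transform N (\<i> * of_real y)) \<longlongrightarrow> 1 - 1) at_top"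
      by (intro tendsto_diff lim N.cauchy_transform_asymptotics)
    then show "((\<lambda>y. \<i> * of_real y * D (\<i> * of_real y)) \<longlongrightarrow> 0) at_top"
      by (simp add: D_def right_diff_distrib)
    show "D (\<i> * of_real y) = D \<i>" if "y > 0" for y by (rule const) (use that in auto)
  qed
  then have "cauchy_transform N z = h z" if "Im z > 0" for z
    using const[OF that, of \<i>] by (simp add: D_def)
  then show ?thesis using that N by blast
qed

text \<open>On the interval y^2 / (s^2 + y^2) is at most 1, outside at most 1/2; integrating bounds
  the tail mass by the Cauchy transform on the imaginary axis, the input for tightness.\<close>

lemma (in real_distribution) prob_interval_ge:
  assumes y: "y > 0"
  shows "2 * (y * - Im (cauchy_transform M (\<i> * of_real y))) - 1 \<le> prob {- y<..y}"
proof -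
  define z where "z = \<i> * complex_of_real y"
  have z: "Im z > 0" using y by (simp add: z_def)
  have ii: "integrable M (indicator {- y<..y} :: real \<Rightarrow> real)" by (simp add: emeasure_eq_measure)
  have "y * - Im (cauchy_transform M z) = (LINT s|M. y\<^sup>2 * (cmod (1 / (z - of_real s)))\<^sup>2)"
    unfolding Im_cauchy_transform[OF z] by (simp add: z_def power2_eq_square)
  also have "\<dots> \<le> (LINT s|M. (1 + indicator {- y<..y} s) / 2)"
  proof (rule integral_mono)
    show "integrable M (\<lambda>s. y\<^sup>2 * (cmod (1 / (z - of_real s)))\<^sup>2)"
      by (intro integrable_mult_right integrable_cauchy_kernel_sq z)
    show "integrable M (\<lambda>s. (1 + indicator {- y<..y} s) / 2 :: real)" using ii by simp
    fix s
    have eq: "y\<^sup>2 * (cmod (1 / (z - of_real s)))\<^sup>2 = y\<^sup>2 / (s\<^sup>2 + y\<^sup>2)"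
      by (simp add: z_def norm_divide power_divide cmod_power2)
    show "y\<^sup>2 * (cmod (1 / (z - of_real s)))\<^sup>2 \<le> (1 + indicator {- y<..y} s) / 2"
    proof (cases "s \<in> {- y<..y}")
      case True
      have "s\<^sup>2 + y\<^sup>2 > 0" using y by (simp add: add_nonneg_pos)
      then have "y\<^sup>2 / (s\<^sup>2 + y\<^sup>2) \<le> 1" by (simp add: pos_divide_le_eq)
      then show ?thesis unfolding eq using True by simp
    next
      case False
      then have "y \<le> \<bar>s\<bar>" by auto
      then have "y\<^sup>2 \<le> \<bar>s\<bar>\<^sup>2" using y by (intro power_mono) auto
      then have "y\<^sup>2 \<le> s\<^sup>2" by simp
      moreover have "s\<^sup>2 + y\<^sup>2 > 0" using y by (simp add: add_nonneg_pos)
      ultimately show ?thesis unfolding eq using False by (simp add: field_simps)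
    qed
  qed
  also have "\<dots> = (1 + prob {- y<..y}) / 2" using ii by simp
  finally show ?thesis by (simp add: z_def)
qed

text \<open>Shifting the argument of G = 1 / (z + g z) up by i e_n, with e_n tending to 0, makes it
  regular on the real line, so each shifted function is the Cauchy transform of a measure. The
  asymptotics of G on the imaginary axis make these measures tight, and a weak limit has transform G
  because the kernel is bounded and continuous.\<close>

proposition nevanlinna_imp_recip_cauchy:
  assumes g: "nevanlinna g"
  obtains M where "M \<in> borel_probs" "\<And>z. Im z > 0 \<Longrightarrow> recip_cauchy M z = z + g z"
proof -
  define G where "G = (\<lambda>z. 1 / (z + g z))"
  have Im_ge: "Im (z + g z) \<ge> Im z" if "Im z > 0" for z
    using nevanlinnaD(2)[OF g that] by simp
  have nz: "z + g z \<noteq> 0" if "Im z > 0" for z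
    using Im_ge[OF that] that by (metis linorder_not_less zero_complex.sel(2))
  have holG: "G holomorphic_on upper_half_plane"
    unfolding G_def by (intro holomorphic_intros nevanlinnaD[OF g]) (use nz in auto)
  have G_bound: "cmod (G z) \<le> 1 / Im z" if "Im z > 0" for z
  proof -
    have "Im z \<le> cmod (z + g z)"
      using Im_ge[OF that] abs_Im_le_cmod[of "z + g z"] by linarith
    then show ?thesis using that by (simp add: G_def norm_divide frac_le)
  qed
  have ImG: "Im (G z) \<le> 0" if "Im z > 0" for z
  proof -
    have "Im (G z) = - Im (z + g z) / (cmod (z + g z))\<^sup>2"
      unfolding G_def by (simp add: Im_divide cmod_power2)
    then show ?thesis using Im_ge[OF that] that by (simp add: divide_nonpos_nonneg)
  qed
  have G_lim: "((\<lambda>y. \<i> * of_real y * G (\<i> * of_real y)) \<longlongrightarrow> 1) at_top"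
  proof -
    have "((\<lambda>y. 1 / (1 + g (\<i> * of_real y) / of_real y * (1 / \<i>))) \<longlongrightarrow> 1 / (1 + 0 * (1 / \<i>))) at_top"
      by (intro tendsto_intros nevanlinnaD[OF g]) auto
    moreover have "\<forall>\<^sub>F y in at_top. 1 / (1 + g (\<i> * of_real y) / of_real y * (1 / \<i>)) = \<i> * of_real y * G (\<i> * of_real y)"
      using eventually_gt_at_top[of 0]
    proof eventually_elim
      case (elim y)
      have "\<i> * of_real y + g (\<i> * of_real y) = \<i> * of_real y * (1 + g (\<i> * of_real y) / of_real y * (1 / \<i>))"
        using elim by (simp add: field_simps)
      then show ?case using elim unfolding G_def by simp
    qed
    ultimately have "((\<lambda>y. \<i> * of_real y * G (\<i> * of_real y)) \<longlongrightarrow> 1 / (1 + 0 * (1 / \<i>))) at_top"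
      by (rule Lim_transform_eventually)
    then show ?thesis by simp
  qed
  define e where "e n = 1 / real (Suc n)" for n
  have e: "e n > 0" "e n \<le> 1" for n by (auto simp: e_def)
  have "\<exists>N. real_distribution N \<and> (\<forall>z. Im z > 0 \<longrightarrow> cauchy_transform N z = G (z + \<i> * of_real (e n)))" for n
  proof (rule cauchy_transform_exists_regular)
    show "(\<lambda>z. G (z + \<i> * of_real (e n))) holomorphic_on {w. Im w > - e n}"
      by (rule holomorphic_on_compose_gen[OF _ holG, unfolded o_def]) (auto intro!: holomorphic_intros)
    show "e n > 0" by (rule e)
    show "cmod (G (w + \<i> * of_real (e n))) \<le> 1 / e n" if "Im w \<ge> 0" for w
    proof -
      have "cmod (G (w + \<i> * of_real (e n))) \<le> 1 / Im (w + \<i> * of_real (e n))"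
        by (rule G_bound) (use that e[of n] in auto)
      also have "\<dots> \<le> 1 / e n" using that e[of n] by (intro frac_le) auto
      finally show ?thesis .
    qed
    show "Im (G (w + \<i> * of_real (e n))) \<le> 0" if "Im w \<ge> 0" for w
      by (rule ImG) (use that e[of n] in auto)
    have "((\<lambda>y. of_real (y / (e n + y)) * (\<i> * of_real (e n + y) * G (\<i> * of_real (e n + y)))) \<longlongrightarrow> of_real 1 * 1) at_top"
    proof (intro tendsto_mult tendsto_of_real)
      show "((\<lambda>y. y / (e n + y)) \<longlongrightarrow> 1) at_top" using e[of n] by real_asymp
      show "((\<lambda>y. \<i> * of_real (e n + y) * G (\<i> * of_real (e n + y))) \<longlongrightarrow> 1) at_top"
        by (rule filterlim_compose[OF G_lim]) (intro filterlim_tendsto_add_at_top[OF tendsto_const] filterlim_ident)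
    qed
    moreover have "\<forall>\<^sub>F y in at_top. of_real (y / (e n + y)) * (\<i> * of_real (e n + y) * G (\<i> * of_real (e n + y)))
        = \<i> * of_real y * G (\<i> * of_real y + \<i> * of_real (e n))"
      using eventually_gt_at_top[of 0]
    proof eventually_elim
      case (elim y)
      then have "complex_of_real (y / (e n + y)) * of_real (e n + y) = of_real y"
        unfolding of_real_mult[symmetric] using e[of n] by simp
      moreover have "\<i> * complex_of_real (e n + y) = \<i> * of_real y + \<i> * of_real (e n)"
        by (simp add: distrib_left)
      ultimately show ?case by (metis mult.assoc mult.commute)
    qed
    ultimately have "((\<lambda>y. \<i> * of_real y * G (\<i> * of_real y + \<i> * of_real (e n))) \<longlongrightarrow> of_real 1 * 1) at_top"
      by (rule Lim_transform_eventually)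
    then show "((\<lambda>y. \<i> * of_real y * G (\<i> * of_real y + \<i> * of_real (e n))) \<longlongrightarrow> 1) at_top" by simp
  qed blast
  then obtain N where N: "\<And>n. real_distribution (N n)"
    and GN: "\<And>n z. Im z > 0 \<Longrightarrow> cauchy_transform (N n) z = G (z + \<i> * of_real (e n))"
    by metis
  have "tight N"
    unfolding tight_def
  proof (intro conjI allI impI N)
    fix \<delta> :: real assume \<delta>: "\<delta> > 0"
    have "((\<lambda>y. Re (\<i> * of_real y * G (\<i> * of_real y))) \<longlongrightarrow> Re 1) at_top"
      by (intro tendsto_Re G_lim)
    then have "((\<lambda>y. y * - Im (G (\<i> * of_real y))) \<longlongrightarrow> 1) at_top" by simp
    then have "\<forall>\<^sub>F y in at_top. 1 - \<delta> / 8 < y * - Im (G (\<i> * of_real y))"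
      by (rule order_tendstoD) (use \<delta> in simp)
    then obtain Y where Y: "\<And>y. y \<ge> Y \<Longrightarrow> 1 - \<delta> / 8 < y * - Im (G (\<i> * of_real y))"
      unfolding eventually_at_top_linorder by auto
    \<comment> \<open>y \<ge> 8 / \<delta> forces a \<le> \<delta> / 8, and e n \<le> 1, so y * a
      \<ge> 1 - \<delta> / 4; doubling and subtracting 1 leaves 1 - \<delta> / 2 > 1 -
      \<delta>.\<close>
    define y where "y = max (max Y 1) (8 / \<delta>)"
    have y: "y \<ge> Y" "y \<ge> 1" "y \<ge> 8 / \<delta>" by (auto simp: y_def)
    have "prob_space.prob (N n) {- y<..y} > 1 - \<delta>" for n
    proof -
      interpret N: real_distribution "N n" by (rule N)
      define a where "a = - Im (G (\<i> * of_real (y + e n)))"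
      have yG: "\<i> * of_real y + \<i> * complex_of_real (e n) = \<i> * of_real (y + e n)"
        by (simp add: distrib_left)
      have a: "1 - \<delta> / 8 < (y + e n) * a" unfolding a_def by (rule Y) (use y e[of n] in auto)
      have "Im (\<i> * complex_of_real (y + e n)) > 0" using y e[of n] by simp
      then have "cmod (G (\<i> * of_real (y + e n))) \<le> 1 / (y + e n)" using G_bound by fastforce
      then have "a \<le> 1 / (y + e n)"
        unfolding a_def using abs_Im_le_cmod[of "G (\<i> * of_real (y + e n))"] by linarith
      also have "\<dots> \<le> 1 / (8 / \<delta>)"
        using y e[of n] \<delta> by (intro divide_left_mono) (auto intro!: mult_pos_pos)
      finally have "a \<le> \<delta> / 8" by simp
      moreover have "e n * a \<le> 1 * (\<delta> / 8)"
        by (rule mult_mono) (use calculation e[of n] \<delta> ImG[of "\<i> * of_real (y + e n)"] y in \<open>auto simp: a_def\<close>)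
      ultimately have "y * a \<ge> 1 - \<delta> / 4" using a by (simp add: distrib_right)
      moreover have "2 * (y * a) - 1 \<le> N.prob {- y<..y}"
        using N.prob_interval_ge[of y] GN[of "\<i> * of_real y" n] y by (simp add: yG a_def)
      ultimately show ?thesis using \<delta> by linarith
    qed
    then show "\<exists>a b. a < b \<and> (\<forall>n. 1 - \<delta> < measure (N n) {a<..b})"
      using y by (intro exI[of _ "- y"] exI[of _ y]) auto
  qed
  from tight_imp_convergent_subsubsequence[OF this strict_mono_id]
  obtain r M where r: "strict_mono (r :: nat \<Rightarrow> nat)" and M: "real_distribution M"
    and conv: "weak_conv_m (N \<circ> id \<circ> r) M" by blast
  have "cauchy_transform M z = G z" if z: "Im z > 0" for z
  proof -
    have "(\<lambda>n. cauchy_transform ((N \<circ> id \<circ> r) n) z) \<longlonglongrightarrow> cauchy_transform M z"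
      unfolding cauchy_transform_def
    proof (rule weak_conv_imp_integral_bdd_continuous_conv[OF _ M conv])
      show "real_distribution ((N \<circ> id \<circ> r) n)" for n using N by simp
      show "isCont (\<lambda>s. 1 / (z - complex_of_real s)) x" for x
        by (intro continuous_intros) (use cauchy_kernel_nonzero[OF z] in auto)
    qed (rule cauchy_kernel_bound[OF z])
    moreover have "(\<lambda>n. cauchy_transform ((N \<circ> id \<circ> r) n) z) \<longlonglongrightarrow> G z"
    proof -
      have "(\<lambda>n. e (r n)) \<longlonglongrightarrow> 0"
        using LIMSEQ_subseq_LIMSEQ[OF LIMSEQ_inverse_real_of_nat r]
        by (simp add: e_def o_def inverse_eq_divide)
      then have "(\<lambda>n. z + \<i> * of_real (e (r n))) \<longlonglongrightarrow> z + \<i> * of_real 0" by (intro tendsto_intros)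
      moreover have "isCont G z"
        using holG z open_upper_half_plane
        by (meson continuous_on_eq_continuous_at holomorphic_on_imp_continuous_on in_upper_half_plane_iff)
      ultimately have "(\<lambda>n. G (z + \<i> * of_real (e (r n)))) \<longlonglongrightarrow> G z"
        by (intro isCont_tendsto_compose[of z G]) auto
      then show ?thesis using GN[OF z] by simp
    qed
    ultimately show ?thesis by (rule LIMSEQ_unique)
  qed
  then have "recip_cauchy M z = z + g z" if "Im z > 0" for z
    using that by (simp add: recip_cauchy_def G_def)
  moreover have "M \<in> borel_probs" using M by (simp add: borel_probs_def)
  ultimately show ?thesis using that by blast
qed

section \<open>Free and Boolean powers\<close>

lemma recip_cauchy_unique:
  assumes "M \<in> borel_probs" "N \<in> borel_probs"
    and eq: "\<And>z. Im z > 0 \<Longrightarrow> recip_cauchy M z = recip_cauchy N z"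
  shows "M = N"
proof (rule cauchy_transform_unique)
  show "cauchy_transform M z = cauchy_transform N z" if "Im z > 0" for z
    using eq[OF that] unfolding recip_cauchy_def by (metis divide_divide_eq_right mult_1 div_by_1)
qed (use assms in \<open>auto simp: borel_probs_def\<close>)

lemma nevanlinna_recip_cauchy_borel_probs:
  "M \<in> borel_probs \<Longrightarrow> nevanlinna (\<lambda>z. recip_cauchy M z - z)"
  by (simp add: borel_probs_def real_distribution.nevanlinna_recip_cauchy)

text \<open>If \<open>f = recip_cauchy \<rho> - id\<close>, then the measure described here is
  the Boolean power of \<open>BB c \<rho>\<close> with exponent \<open>t\<close>, and its
  Voiculescu transform is \<open>- t f\<close> composed with the inverse of \<open>w + (t - c) f(w)\<close>: only
  \<open>t - c\<close> enters the inverse, so the free powers keep \<open>f\<close> and \<open>t - c\<close>.\<close>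

definition subordination_param ::
    "(complex \<Rightarrow> complex) \<Rightarrow> real \<Rightarrow> real \<Rightarrow> real measure \<Rightarrow> bool" where
  "subordination_param f c t M \<longleftrightarrow> M \<in> borel_probs \<and>
     (\<forall>w. Im w > 0 \<longrightarrow> Im (w - of_real c * f w) > 0 \<longrightarrow>
        recip_cauchy M (w - of_real c * f w) = w + of_real (t - c) * f w)"

lemma filterlim_imaginary_axis:
  assumes "\<alpha> > 0"
  shows "filterlim (\<lambda>y. \<i> * complex_of_real y) (inf at_infinity (principal (trunc_cone \<alpha> \<beta>))) at_top"
  unfolding filterlim_inf filterlim_principal
proof
  show "filterlim (\<lambda>y. \<i> * complex_of_real y) at_infinity at_top"
    unfolding filterlim_at_infinity[OF order_refl]
  proof (intro allI impI)
    fix r :: real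
    show "\<forall>\<^sub>F y in at_top. r \<le> cmod (\<i> * complex_of_real y)"
      using eventually_ge_at_top[of r] by eventually_elim (simp add: norm_mult)
  qed
  show "\<forall>\<^sub>F y in at_top. \<i> * complex_of_real y \<in> trunc_cone \<alpha> \<beta>"
    using eventually_gt_at_top[of "max 0 \<beta>"]
    by eventually_elim (rule imaginary_in_trunc_cone, use assms in auto)
qed

text \<open>The measure has F z = z + t f (\<omega> z) with \<omega> inverse to
  \<open>w - c f w\<close>; t \<ge> 0 keeps the second summand a Nevanlinna function. Its growth on
  the imaginary axis comes from the contraction inverse J, with which \<omega> coincides in a
  cone.\<close>

lemma subordination_param_exists:
  assumes f: "nevanlinna f" and "c \<ge> 0" "t \<ge> 0"
  obtains M where "subordination_param f c t M"
proof -
  obtain \<omega> where hol\<omega>: "\<omega> holomorphic_on upper_half_plane"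
    and \<omega>_pos: "\<And>z. Im z > 0 \<Longrightarrow> Im (\<omega> z) > 0"
    and \<omega>: "\<And>w. Im w > 0 \<Longrightarrow> Im (w - of_real c * f w) > 0 \<Longrightarrow> \<omega> (w - of_real c * f w) = w"
    by (rule nevanlinna_subordination[OF nevanlinna_cmult[OF f \<open>c \<ge> 0\<close>]]) blast
  obtain \<beta> J where \<beta>: "\<beta> > 0"
    and J_pos: "\<And>z. z \<in> trunc_cone 1 \<beta> \<Longrightarrow> Im (J z) > 0"
    and J: "\<And>z. z \<in> trunc_cone 1 \<beta> \<Longrightarrow> J z + of_real (- c) * f (J z) = z"
    and J_lim: "((\<lambda>z. f (J z) / z) \<longlongrightarrow> 0) (inf at_infinity (principal (trunc_cone 1 \<beta>)))"
    by (rule perturbed_identity_right_inverse[OF f zero_less_one, where \<kappa> = "- c"]) blast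
  have \<omega>J: "\<omega> z = J z" if z: "z \<in> trunc_cone 1 \<beta>" for z
  proof -
    have "J z - of_real c * f (J z) = z" using J[OF z] by simp
    moreover have "Im z > 0" using z by (simp add: trunc_cone_def)
    ultimately show ?thesis using \<omega>[OF J_pos[OF z]] by simp
  qed
  have "nevanlinna (\<lambda>z. f (\<omega> z))"
    unfolding nevanlinna_def
  proof (intro conjI allI impI)
    show "(\<lambda>z. f (\<omega> z)) holomorphic_on upper_half_plane"
      by (rule holomorphic_on_compose_gen[OF hol\<omega> nevanlinnaD(1)[OF f], unfolded o_def])
         (use \<omega>_pos in auto)
    show "Im (f (\<omega> z)) \<ge> 0" if "Im z > 0" for z
      by (intro nevanlinnaD(2)[OF f] \<omega>_pos that)
    have "((\<lambda>y. \<i> * (f (J (\<i> * of_real y)) / (\<i> * of_real y))) \<longlongrightarrow> \<i> * 0) at_top"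
      by (intro tendsto_intros filterlim_compose[OF J_lim] filterlim_imaginary_axis) simp
    moreover have "\<forall>\<^sub>F y in at_top. \<i> * (f (J (\<i> * of_real y)) / (\<i> * of_real y)) = f (\<omega> (\<i> * of_real y)) / of_real y"
      using eventually_gt_at_top[of \<beta>]
    proof eventually_elim
      case (elim y)
      then have "\<omega> (\<i> * of_real y) = J (\<i> * of_real y)"
        using \<beta> by (intro \<omega>J imaginary_in_trunc_cone) auto
      then show ?case by simp
    qed
    ultimately have "((\<lambda>y. f (\<omega> (\<i> * of_real y)) / of_real y) \<longlongrightarrow> \<i> * 0) at_top"
      by (rule Lim_transform_eventually)
    then show "((\<lambda>y. f (\<omega> (\<i> * of_real y)) / of_real y) \<longlongrightarrow> 0) at_top" by simp
  qed
  then have "nevanlinna (\<lambda>z. of_real t * f (\<omega> z))" using \<open>t \<ge> 0\<close> by (rule nevanlinna_cmult)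
  then obtain M where M: "M \<in> borel_probs"
    and FM: "\<And>z. Im z > 0 \<Longrightarrow> recip_cauchy M z = z + of_real t * f (\<omega> z)"
    by (rule nevanlinna_imp_recip_cauchy) blast
  have "subordination_param f c t M"
    unfolding subordination_param_def using M FM \<omega> by (auto simp: left_diff_distrib)
  then show ?thesis by (rule that)
qed

text \<open>With w = J z, the point z - t f w equals w - c f w, at which the defining identity
  returns w + (t - c) f w = z. The bound |t| \<delta> < 1 guarantees that this point lies in the
  upper half-plane, as that identity demands.\<close>

lemma subordination_param_inverse:
  assumes M: "subordination_param f c t M"
    and J: "J holomorphic_on trunc_cone 1 \<beta>"
      "\<And>z. z \<in> trunc_cone 1 \<beta> \<Longrightarrow> Im (J z) > 0"
      "\<And>z. z \<in> trunc_cone 1 \<beta> \<Longrightarrow> J z + of_real (t - c) * f (J z) = z"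
      "\<And>z. z \<in> trunc_cone 1 \<beta> \<Longrightarrow> cmod (f (J z)) \<le> \<delta> * Im z"
      "((\<lambda>z. f (J z) / z) \<longlongrightarrow> 0) (inf at_infinity (principal (trunc_cone 1 \<beta>)))"
    and f: "nevanlinna f" and t\<delta>: "\<bar>t\<bar> * \<delta> < 1"
  shows "recip_cauchy_inverse M 1 \<beta> (\<lambda>z. z - of_real t * f (J z))"
  unfolding recip_cauchy_inverse_def
proof (intro conjI ballI image_subsetI)
  have fJ: "(\<lambda>z. f (J z)) holomorphic_on trunc_cone 1 \<beta>"
    by (rule holomorphic_on_compose_gen[OF J(1) nevanlinnaD(1)[OF f], unfolded o_def]) (use J(2) in auto)
  show "(\<lambda>z. z - of_real t * f (J z)) holomorphic_on trunc_cone 1 \<beta>"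
    by (intro holomorphic_intros fJ)
  fix z assume z: "z \<in> trunc_cone 1 \<beta>"
  then have Imz: "Im z > 0" by (simp add: trunc_cone_def)
  have "\<bar>t * Im (f (J z))\<bar> \<le> \<bar>t\<bar> * (\<delta> * Im z)"
    unfolding abs_mult using abs_Im_le_cmod[of "f (J z)"] J(4)[OF z] by (intro mult_left_mono) auto
  also have "\<dots> = (\<bar>t\<bar> * \<delta>) * Im z" by simp
  also have "\<dots> < 1 * Im z" using t\<delta> Imz by (rule mult_strict_right_mono)
  finally have pos: "Im (z - of_real t * f (J z)) > 0" by simp
  then show "z - of_real t * f (J z) \<in> upper_half_plane" by simp
  have eq: "z - of_real t * f (J z) = J z - of_real c * f (J z)"
    using J(3)[OF z] by (simp add: algebra_simps)
  show "recip_cauchy M (z - of_real t * f (J z)) = z"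
    using M J(2)[OF z] pos unfolding subordination_param_def eq
    by (simp add: J(3)[OF z] del: of_real_diff)
next
  have "((\<lambda>z. 1 - of_real t * (f (J z) / z)) \<longlongrightarrow> 1 - of_real t * 0) (inf at_infinity (principal (trunc_cone 1 \<beta>)))"
    by (intro tendsto_intros J(5))
  moreover have "\<forall>\<^sub>F z in inf at_infinity (principal (trunc_cone 1 \<beta>)).
      1 - of_real t * (f (J z) / z) = (z - of_real t * f (J z)) / z"
    unfolding eventually_inf_principal
    by (rule always_eventually) (auto simp: trunc_cone_def diff_divide_distrib)
  ultimately have "((\<lambda>z. (z - of_real t * f (J z)) / z) \<longlongrightarrow> 1 - of_real t * 0)
      (inf at_infinity (principal (trunc_cone 1 \<beta>)))"
    by (rule Lim_transform_eventually)
  then show "((\<lambda>z. (z - of_real t * f (J z)) / z) \<longlongrightarrow> 1) (inf at_infinity (principal (trunc_cone 1 \<beta>)))"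
    by simp
qed

lemma subordination_param_free_power:
  assumes f: "nevanlinna f" and M: "subordination_param f c t M" and N: "subordination_param f c' t' N"
    and diff: "t' - c' = t - c" and "t \<noteq> 0"
  shows "is_free_power M (t' / t) N"
proof -
  \<comment> \<open>Small enough for |t| * \<delta> and |t'| * \<delta> at once, so a single J on a
    single cone serves both measures.\<close>
  define \<delta> where "\<delta> = 1 / (\<bar>t\<bar> + \<bar>t'\<bar> + 1)"
  have \<delta>: "\<delta> > 0" unfolding \<delta>_def by (simp add: add_nonneg_pos)
  have t\<delta>: "\<bar>t\<bar> * \<delta> < 1" "\<bar>t'\<bar> * \<delta> < 1"
    unfolding \<delta>_def by (simp_all add: divide_less_eq add_nonneg_pos)
  obtain \<beta> J where \<beta>: "\<beta> > 0"
    and J: "J holomorphic_on trunc_cone 1 \<beta>"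
      "\<And>z. z \<in> trunc_cone 1 \<beta> \<Longrightarrow> Im (J z) > 0"
      "\<And>z. z \<in> trunc_cone 1 \<beta> \<Longrightarrow> J z + of_real (t - c) * f (J z) = z"
      "\<And>z. z \<in> trunc_cone 1 \<beta> \<Longrightarrow> cmod (f (J z)) \<le> \<delta> * Im z"
      "((\<lambda>z. f (J z) / z) \<longlongrightarrow> 0) (inf at_infinity (principal (trunc_cone 1 \<beta>)))"
    by (rule perturbed_identity_right_inverse[OF f \<delta>, where \<kappa> = "t - c"]) blast
  define V where "V = (\<lambda>u z. - (complex_of_real u * f (J z)))"
  have "voiculescu_transform M 1 \<beta> (V t)"
    unfolding voiculescu_transform_def V_def
    by (intro exI[of _ "\<lambda>z. z - of_real t * f (J z)"] conjI
        subordination_param_inverse[OF M J f t\<delta>(1)]) auto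
  moreover have "voiculescu_transform N 1 \<beta> (V t')"
    unfolding voiculescu_transform_def V_def
    by (intro exI[of _ "\<lambda>z. z - of_real t' * f (J z)"] conjI
        subordination_param_inverse[OF N J(1,2) J(3)[folded diff] J(4,5) f t\<delta>(2)]) auto
  moreover have "V t' z = of_real (t' / t) * V t z" for z
    unfolding V_def using \<open>t \<noteq> 0\<close> by simp
  moreover have "N \<in> borel_probs" using N by (simp add: subordination_param_def)
  ultimately show ?thesis unfolding is_free_power_def using \<beta> zero_less_one by blast
qed

section \<open>Uniqueness of right inverses and of free powers\<close>

lemma recip_cauchy_inverse_Im_ge:
  assumes H: "recip_cauchy_inverse M \<alpha> \<beta> H" and "\<alpha> > 0"
  obtains b where "\<And>z. z \<in> trunc_cone \<alpha> (max b \<beta>) \<Longrightarrow> Im (H z) \<ge> 2 / 3 * Im z"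
proof -
  \<comment> \<open>On the cone |z| \<le> (1 + \<alpha>) Im z, so this choice gives |H z - z| \<le>
    Im z / 3. The resulting 2/3 is tuned to uniqueness: Im z - Im (H z) \<le> Im (H z) / 2.\<close>
  define \<eta> where "\<eta> = 1 / (3 * (1 + \<alpha>))"
  have \<eta>: "\<eta> > 0" unfolding \<eta>_def using \<open>\<alpha> > 0\<close> by simp
  have "((\<lambda>z. H z / z) \<longlongrightarrow> 1) (inf at_infinity (principal (trunc_cone \<alpha> \<beta>)))"
    using H by (simp add: recip_cauchy_inverse_def)
  from tendstoD[OF this \<eta>] obtain b where
    b: "\<And>z. z \<in> trunc_cone \<alpha> \<beta> \<Longrightarrow> cmod z \<ge> b \<Longrightarrow> dist (H z / z) 1 < \<eta>"
    unfolding eventually_at_infinity_within by blast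
  show ?thesis
  proof (rule that)
    fix z assume z: "z \<in> trunc_cone \<alpha> (max b \<beta>)"
    then have z': "z \<in> trunc_cone \<alpha> \<beta>" "Im z > b" "Im z > 0" by (auto simp: trunc_cone_def)
    have "cmod z \<ge> b" using abs_Im_le_cmod[of z] z' by linarith
    then have d: "cmod (H z / z - 1) < \<eta>" using b[OF z'(1)] by (simp add: dist_norm)
    have nz: "z \<noteq> 0" using z'(3) by auto
    have "H z - z = (H z / z - 1) * z" using nz by (simp add: left_diff_distrib)
    then have "cmod (H z - z) = cmod (H z / z - 1) * cmod z" by (simp only: norm_mult)
    also have "\<dots> \<le> \<eta> * ((1 + \<alpha>) * Im z)"
      using d \<eta> cmod_le_on_cone[OF z] by (intro mult_mono) auto
    also have "\<dots> = 1 / 3 * Im z" unfolding \<eta>_def using \<open>\<alpha> > 0\<close> by (simp add: field_simps)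
    finally show "Im (H z) \<ge> 2 / 3 * Im z" using abs_Im_le_cmod[of "H z - z"] by simp
  qed
qed

text \<open>With f = F - id, both inverses satisfy f (H z) = z - H z, so |f (H1 z) - f (H2 z)| = |H1
  z - H2 z|, while Schwarz-Pick gives Lipschitz constant 1/2 at these points. The inverses may live
  on different cones; agreement is obtained far out in the narrower one.\<close>

lemma recip_cauchy_inverse_unique:
  assumes M: "M \<in> borel_probs"
    and H1: "recip_cauchy_inverse M \<alpha>1 \<beta>1 H1" "\<alpha>1 > 0" and H2: "recip_cauchy_inverse M \<alpha>2 \<beta>2 H2" "\<alpha>2 > 0"
  obtains b where "b \<ge> \<beta>1" "b \<ge> \<beta>2" "\<And>z. z \<in> trunc_cone (min \<alpha>1 \<alpha>2) b \<Longrightarrow> H1 z = H2 z"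
proof -
  obtain b1 where b1: "\<And>z. z \<in> trunc_cone \<alpha>1 (max b1 \<beta>1) \<Longrightarrow> Im (H1 z) \<ge> 2 / 3 * Im z"
    by (rule recip_cauchy_inverse_Im_ge[OF H1]) blast
  obtain b2 where b2: "\<And>z. z \<in> trunc_cone \<alpha>2 (max b2 \<beta>2) \<Longrightarrow> Im (H2 z) \<ge> 2 / 3 * Im z"
    by (rule recip_cauchy_inverse_Im_ge[OF H2]) blast
  define f where "f = (\<lambda>z. recip_cauchy M z - z)"
  have f: "nevanlinna f" unfolding f_def by (rule nevanlinna_recip_cauchy_borel_probs[OF M])
  show ?thesis
  proof (rule that)
    show "max (max b1 \<beta>1) (max b2 \<beta>2) \<ge> \<beta>1" "max (max b1 \<beta>1) (max b2 \<beta>2) \<ge> \<beta>2" by auto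
    fix z assume z: "z \<in> trunc_cone (min \<alpha>1 \<alpha>2) (max (max b1 \<beta>1) (max b2 \<beta>2))"
    have z1: "z \<in> trunc_cone \<alpha>1 (max b1 \<beta>1)" and z2: "z \<in> trunc_cone \<alpha>2 (max b2 \<beta>2)"
      by (rule subsetD[OF trunc_cone_mono z]; simp)+
    have z3: "z \<in> trunc_cone \<alpha>1 \<beta>1" "z \<in> trunc_cone \<alpha>2 \<beta>2"
      by (rule subsetD[OF trunc_cone_mono z]; simp)+
    have Imz: "Im z > 0" using z by (simp add: trunc_cone_def)
    have f1: "f (H1 z) = z - H1 z" using H1(1) z3 by (simp add: recip_cauchy_inverse_def f_def)
    have f2: "f (H2 z) = z - H2 z" using H2(1) z3 by (simp add: recip_cauchy_inverse_def f_def)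
    have "cmod (f (H1 z) - f (H2 z)) \<le> (1 / 2 + 1 / 2) / 2 * cmod (H1 z - H2 z)"
    proof (rule schwarz_pick_lipschitz)
      show "Im (H1 z) > 0" "Im (H2 z) > 0" using b1[OF z1] b2[OF z2] Imz by auto
      show "Im (f (H1 z)) \<le> 1 / 2 * Im (H1 z)" "Im (f (H2 z)) \<le> 1 / 2 * Im (H2 z)"
        unfolding f1 f2 using b1[OF z1] b2[OF z2] by auto
    qed (use nevanlinnaD[OF f] in auto)
    then have "cmod (H1 z - H2 z) \<le> 1 / 2 * cmod (H1 z - H2 z)"
      unfolding f1 f2 by (simp add: norm_minus_commute)
    then have "cmod (H1 z - H2 z) \<le> 0" by simp
    then show "H1 z = H2 z" by simp
  qed
qed

text \<open>Needed because \<open>free_power\<close> is a definite description. The right inverses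
  for N1 and N2 agree far out in a cone, so the two reciprocal transforms agree on the open image of
  that cone, and the identity theorem extends this to the half-plane.\<close>

lemma free_power_unique:
  assumes M: "M \<in> borel_probs" and 1: "is_free_power M t N1" and 2: "is_free_power M t N2"
  shows "N1 = N2"
proof -
  obtain \<alpha>1 \<beta>1 H1 K1 where \<alpha>1: "\<alpha>1 > 0"
    and H1: "recip_cauchy_inverse M \<alpha>1 \<beta>1 H1" and K1: "recip_cauchy_inverse N1 \<alpha>1 \<beta>1 K1"
    and HK1: "\<And>z. z \<in> trunc_cone \<alpha>1 \<beta>1 \<Longrightarrow> K1 z - z = of_real t * (H1 z - z)"
    using 1 unfolding is_free_power_def voiculescu_transform_def by metis
  obtain \<alpha>2 \<beta>2 H2 K2 where \<alpha>2: "\<alpha>2 > 0"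
    and H2: "recip_cauchy_inverse M \<alpha>2 \<beta>2 H2" and K2: "recip_cauchy_inverse N2 \<alpha>2 \<beta>2 K2"
    and HK2: "\<And>z. z \<in> trunc_cone \<alpha>2 \<beta>2 \<Longrightarrow> K2 z - z = of_real t * (H2 z - z)"
    using 2 unfolding is_free_power_def voiculescu_transform_def by metis
  obtain b where b: "b \<ge> \<beta>1" "b \<ge> \<beta>2"
    and H12: "\<And>z. z \<in> trunc_cone (min \<alpha>1 \<alpha>2) b \<Longrightarrow> H1 z = H2 z"
    by (rule recip_cauchy_inverse_unique[OF M H1 \<alpha>1 H2 \<alpha>2]) blast
  define C where "C = trunc_cone (min \<alpha>1 \<alpha>2) b"
  have C1: "C \<subseteq> trunc_cone \<alpha>1 \<beta>1" and C2: "C \<subseteq> trunc_cone \<alpha>2 \<beta>2"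
    unfolding C_def using b by (intro trunc_cone_mono; simp)+
  have K12: "K1 z = K2 z" if "z \<in> C" for z
  proof -
    have "K1 z - z = K2 z - z"
      using HK1[OF subsetD[OF C1 that]] HK2[OF subsetD[OF C2 that]] H12[of z] that by (simp add: C_def)
    then show ?thesis by simp
  qed
  have F1: "recip_cauchy N1 (K1 z) = z" and pos: "Im (K1 z) > 0" if "z \<in> C" for z
    using K1 subsetD[OF C1 that] by (auto simp: recip_cauchy_inverse_def)
  have F2: "recip_cauchy N2 (K1 z) = z" if "z \<in> C" for z
    using K2 subsetD[OF C2 that] K12[OF that] by (auto simp: recip_cauchy_inverse_def)
  have holF: "recip_cauchy N holomorphic_on upper_half_plane" if "N \<in> borel_probs" for N
  proof -
    have "(\<lambda>z. (recip_cauchy N z - z) + z) holomorphic_on upper_half_plane"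
      by (intro holomorphic_intros nevanlinnaD(1) nevanlinna_recip_cauchy_borel_probs that)
    then show ?thesis by simp
  qed
  have N: "N1 \<in> borel_probs" "N2 \<in> borel_probs" using 1 2 by (auto simp: is_free_power_def)
  have holK: "K1 holomorphic_on C"
    using K1 C1 by (auto simp: recip_cauchy_inverse_def intro: holomorphic_on_subset)
  have injK: "inj_on K1 C" by (metis F1 inj_onI)
  have "open (K1 ` C)"
    using holK _ injK by (rule open_mapping_thm3) (simp add: C_def open_trunc_cone)
  moreover have "K1 ` C \<noteq> {}"
    using imaginary_in_trunc_cone[of "min \<alpha>1 \<alpha>2" "max 1 (b + 1)" b] \<alpha>1 \<alpha>2 unfolding C_def by force
  moreover have "K1 ` C \<subseteq> upper_half_plane" using pos by auto
  moreover have "recip_cauchy N1 u = recip_cauchy N2 u" if "u \<in> K1 ` C" for u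
    using that F1 F2 by auto
  ultimately have "recip_cauchy N1 z = recip_cauchy N2 z" if "Im z > 0" for z
    using analytic_continuation_open[OF _ open_upper_half_plane _ convex_connected[OF convex_upper_half_plane]
        _ holF[OF N(1)] holF[OF N(2)], of "K1 ` C" z] that by simp
  then show ?thesis by (intro recip_cauchy_unique N)
qed

section \<open>Evaluation of the powers, and the functions attached to the range of
  \<open>BB\<close>\<close>

lemma free_power_eqI:
  assumes "M \<in> borel_probs" "is_free_power M t N"
  shows "free_power M t = N"
  unfolding free_power_def using assms free_power_unique by (intro the_equality) auto

lemma boolean_power_eqI:
  assumes "is_boolean_power M t N"
  shows "boolean_power M t = N"
  unfolding boolean_power_def
proof (rule the_equality[of "is_boolean_power M t", OF assms])
  show "N' = N" if "is_boolean_power M t N'" for N'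
    using that assms unfolding is_boolean_power_def by (intro recip_cauchy_unique) auto
qed

text \<open>If \<omega> inverts \<open>w - s f w\<close>, with f = F - id for \<rho>, then F - id
  for \<open>BB s \<rho>\<close> is g = f \<circ> \<omega>, and \<omega> z = z + s g z. Substituting
  eliminates \<omega>: s enters only as a coefficient, so it can be varied with g fixed.\<close>

lemma BB_subordination:
  assumes \<rho>: "\<rho> \<in> borel_probs" and s: "s \<ge> 0"
  obtains f where "nevanlinna f"
    "\<And>z. Im z > 0 \<Longrightarrow>
       f (z + of_real s * (recip_cauchy (BB s \<rho>) z - z)) = recip_cauchy (BB s \<rho>) z - z"
proof -
  define f where "f = (\<lambda>z. recip_cauchy \<rho> z - z)"
  have f: "nevanlinna f" unfolding f_def by (rule nevanlinna_recip_cauchy_borel_probs[OF \<rho>])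
  obtain M where M: "subordination_param f s (1 + s) M"
    using subordination_param_exists[OF f s, of "1 + s"] s by auto
  have Mb: "M \<in> borel_probs" using M by (simp add: subordination_param_def)
  \<comment> \<open>\<rho> itself has parameters (0, 1), with the same difference 1 as (s, 1 +
    s).\<close>
  have "subordination_param f 0 1 \<rho>" using \<rho> by (simp add: subordination_param_def f_def)
  then have "is_free_power \<rho> ((1 + s) / 1) M"
    by (intro subordination_param_free_power[OF f _ M]) auto
  then have M_eq: "free_power \<rho> (1 + s) = M" by (intro free_power_eqI \<rho>) simp
  have "nevanlinna (\<lambda>z. of_real (1 / (1 + s)) * (recip_cauchy M z - z))"
    using s by (intro nevanlinna_cmult nevanlinna_recip_cauchy_borel_probs Mb) simp
  then obtain B where B: "B \<in> borel_probs"
    and FB: "\<And>z. Im z > 0 \<Longrightarrow> recip_cauchy B z = z + of_real (1 / (1 + s)) * (recip_cauchy M z - z)"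
    by (rule nevanlinna_imp_recip_cauchy) blast
  have "is_boolean_power M (1 / (1 + s)) B"
  proof -
    define u where "u = 1 / (1 + s)"
    have "z + of_real u * (recip_cauchy M z - z) = of_real u * recip_cauchy M z + of_real (1 - u) * z" for z
      by (simp add: algebra_simps)
    then show ?thesis unfolding is_boolean_power_def using B FB by (simp add: u_def)
  qed
  then have B_eq: "BB s \<rho> = B" unfolding BB_def M_eq by (rule boolean_power_eqI)
  obtain \<omega> where \<omega>: "\<And>z. Im z > 0 \<Longrightarrow> Im (\<omega> z) > 0"
    "\<And>z. Im z > 0 \<Longrightarrow> \<omega> z - of_real s * f (\<omega> z) = z"
    by (rule nevanlinna_subordination[OF nevanlinna_cmult[OF f s]]) blast
  show ?thesis
  proof (rule that[OF f])
    fix z assume z: "Im z > 0"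
    \<comment> \<open>For parameters (s, 1 + s) the coefficient t - c is 1; subtracting z = \<omega>
      z - s f (\<omega> z) leaves the factor 1 + s, which the Boolean power divides out.\<close>
    have "recip_cauchy M z = \<omega> z + f (\<omega> z)"
      using M \<omega>[OF z] z unfolding subordination_param_def by (metis add_diff_cancel_right' mult_1 of_real_1)
    also have "\<dots> - z = of_real (1 + s) * f (\<omega> z)"
      using \<omega>(2)[OF z] by (simp add: algebra_simps)
    finally have "recip_cauchy B z - z = of_real (1 / (1 + s)) * (of_real (1 + s) * f (\<omega> z))"
      using FB[OF z] by simp
    also have "\<dots> = f (\<omega> z)" unfolding mult.assoc[symmetric] of_real_mult[symmetric] using s by simp
    finally have g: "recip_cauchy B z - z = f (\<omega> z)" .
    have "z + of_real s * f (\<omega> z) = \<omega> z" using \<omega>(2)[OF z] by (simp add: algebra_simps)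
    then show "f (z + of_real s * (recip_cauchy (BB s \<rho>) z - z)) = recip_cauchy (BB s \<rho>) z - z"
      unfolding B_eq g by simp
  qed
qed

text \<open>Each F n takes the value g i at u n i, and these points stay bounded with imaginary part
  at least 1; Harnack turns this into local bounds, and Montel's theorem gives a limit f. Locally
  uniform limits can lose the growth condition, which is recovered from the limiting
  identity.\<close>

lemma subordination_limit:
  assumes g: "nevanlinna g" and F: "\<And>n. nevanlinna (F n)" and s0: "\<And>n. s n \<ge> 0"
    and s: "s \<longlonglongrightarrow> \<phi>"
    and Fg: "\<And>n z. Im z > 0 \<Longrightarrow> F n (z + of_real (s n) * g z) = g z"
  obtains f where "nevanlinna f" "\<And>z. Im z > 0 \<Longrightarrow> f (z + of_real \<phi> * g z) = g z"
proof -
  note FD = nevanlinnaD[OF F]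
  have \<phi>: "\<phi> \<ge> 0" using s s0 by (intro LIMSEQ_le_const) auto
  define u where "u = (\<lambda>n z. z + of_real (s n) * g z)"
  have Im_u: "Im (u n z) \<ge> Im z" if "Im z > 0" for n z
    using nevanlinnaD(2)[OF g that] s0[of n] by (simp add: u_def)
  have u_lim: "(\<lambda>n. u n z) \<longlonglongrightarrow> z + of_real \<phi> * g z" for z
    unfolding u_def by (intro tendsto_intros s)
  obtain B where B: "\<And>n. cmod (u n \<i>) \<le> B"
    using convergent_imp_bounded[OF u_lim[of \<i>]] by (auto simp: bounded_iff)
  have bounded: "\<exists>B. \<forall>h\<in>range F. \<forall>z\<in>K. cmod (h z) \<le> B"
    if K: "compact K" "K \<subseteq> upper_half_plane" for K
  proof (cases "K = {}")
    case False
    obtain z0 where z0: "z0 \<in> K" "\<And>z. z \<in> K \<Longrightarrow> Im z0 \<le> Im z"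
      using continuous_attains_inf[OF K(1) False continuous_on_Im[OF continuous_on_id]] by blast
    obtain A where A: "\<And>z. z \<in> K \<Longrightarrow> cmod z \<le> A"
      using compact_imp_bounded[OF K(1)] by (auto simp: bounded_iff)
    have m: "Im z0 > 0" using z0(1) K(2) by auto
    have AB: "A + B \<ge> 0" using A[OF z0(1)] B[of 0] norm_ge_zero order_trans by (meson add_nonneg_nonneg)
    \<comment> \<open>Im z \<ge> Im z0 on K and Im (u n i) \<ge> 1, so (A + B)^2 / Im z0 is an
      admissible Harnack constant for all n.\<close>
    have "cmod (F n z) \<le> (2 + (A + B)\<^sup>2 / Im z0) * cmod (g \<i>)" if z: "z \<in> K" for n z
    proof -
      have Imz: "Im z > 0" using z0(2)[OF z] m by simp
      have "cmod (F n z) \<le> (2 + (A + B)\<^sup>2 / Im z0) * cmod (F n (u n \<i>))"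
      proof (rule schwarz_pick_growth[OF FD(1) FD(2)])
        show "Im (u n \<i>) > 0" using Im_u[of \<i> n] by simp
        have "cmod (z - u n \<i>) \<le> A + B"
          using norm_triangle_ineq4[of z "u n \<i>"] A[OF z] B[of n] by linarith
        then have "(cmod (z - u n \<i>))\<^sup>2 \<le> (A + B)\<^sup>2" by (rule power_mono) simp
        also have "\<dots> = (A + B)\<^sup>2 / Im z0 * (Im z0 * 1)" using m by simp
        also have "\<dots> \<le> (A + B)\<^sup>2 / Im z0 * (Im z * Im (u n \<i>))"
          using m z0(2)[OF z] Im_u[of \<i> n] Imz by (intro mult_left_mono mult_mono) auto
        finally show "(cmod (z - u n \<i>))\<^sup>2 \<le> (A + B)\<^sup>2 / Im z0 * (Im z * Im (u n \<i>))" .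
      qed (use Imz m in auto)
      also have "F n (u n \<i>) = g \<i>" unfolding u_def by (rule Fg) simp
      finally show ?thesis .
    qed
    then show ?thesis by blast
  qed simp
  obtain f r where holf: "f holomorphic_on upper_half_plane" and r: "strict_mono (r :: nat \<Rightarrow> nat)"
    and lim: "\<And>z. z \<in> upper_half_plane \<Longrightarrow> (\<lambda>n. F (r n) z) \<longlonglongrightarrow> f z"
    by (rule Montel[OF open_upper_half_plane, of "range F" F]) (use FD(1) bounded in auto)
  have Imf: "Im (f z) \<ge> 0" if "Im z > 0" for z
    using tendsto_Im[OF lim[of z]] FD(2)[OF that] that by (intro LIMSEQ_le_const) auto
  have fg: "f (z + of_real \<phi> * g z) = g z" if z: "Im z > 0" for z
  proof -
    define w where "w = z + of_real \<phi> * g z"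
    have w: "Im w > 0" using nevanlinnaD(2)[OF g z] \<phi> z by (simp add: w_def add_pos_nonneg)
    have ul: "(\<lambda>n. u (r n) z) \<longlonglongrightarrow> w"
      using LIMSEQ_subseq_LIMSEQ[OF u_lim[of z] r] by (simp add: o_def w_def)
    have fl: "(\<lambda>n. F (r n) w) \<longlonglongrightarrow> f w" using lim w by simp
    \<comment> \<open>Function and argument vary together in F n (u n z) = g z. Schwarz-Pick between
      u (r n) z and the fixed w plays the part of equicontinuity; in the limit the right-hand side
      vanishes.\<close>
    have "(cmod (g z - f w))\<^sup>2 * (Im w * Im w) \<le> (cmod (w - w))\<^sup>2 * (Im (g z) * Im (f w))"
    proof (rule LIMSEQ_le)
      show "(\<lambda>n. (cmod (g z - F (r n) w))\<^sup>2 * (Im (u (r n) z) * Im w)) \<longlonglongrightarrow> (cmod (g z - f w))\<^sup>2 * (Im w * Im w)"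
        by (intro tendsto_intros ul fl)
      show "(\<lambda>n. (cmod (u (r n) z - w))\<^sup>2 * (Im (g z) * Im (F (r n) w))) \<longlonglongrightarrow> (cmod (w - w))\<^sup>2 * (Im (g z) * Im (f w))"
        by (intro tendsto_intros ul fl)
      have "(cmod (g z - F (r n) w))\<^sup>2 * (Im (u (r n) z) * Im w) \<le> (cmod (u (r n) z - w))\<^sup>2 * (Im (g z) * Im (F (r n) w))" for n
        using schwarz_pick[OF nevanlinnaD(1,2)[OF F[of "r n"]], of "u (r n) z" w] Im_u[OF z, of "r n"] z w Fg[OF z, of "r n"]
        by (simp add: u_def)
      then show "\<exists>N. \<forall>n\<ge>N. (cmod (g z - F (r n) w))\<^sup>2 * (Im (u (r n) z) * Im w)
          \<le> (cmod (u (r n) z - w))\<^sup>2 * (Im (g z) * Im (F (r n) w))" by blast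
    qed
    then have "(cmod (g z - f w))\<^sup>2 * (Im w * Im w) \<le> 0" by simp
    then have "cmod (g z - f w) = 0" using w by (simp add: mult_le_0_iff)
    then show ?thesis by (simp add: w_def)
  qed
  have "((\<lambda>y. f (\<i> * of_real y) / of_real y) \<longlongrightarrow> 0) at_top"
  proof (rule Lim_null_comparison)
    have "\<forall>\<^sub>F y in at_top. dist (g (\<i> * of_real y) / of_real y) 0 < 1"
      using nevanlinnaD(3)[OF g] by (rule tendstoD) simp
    then show "\<forall>\<^sub>F y in at_top. norm (f (\<i> * of_real y) / of_real y)
        \<le> (2 + \<phi>\<^sup>2) * norm (g (\<i> * of_real y) / of_real y)"
      using eventually_gt_at_top[of 0]
    proof eventually_elim
      case (elim y)
      define z where "z = \<i> * complex_of_real y"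
      have z: "Im z > 0" "Im z = y" using elim by (auto simp: z_def)
      have gz: "cmod (g z) \<le> y" using elim by (simp add: norm_divide z_def)
      have Imw: "Im (z + of_real \<phi> * g z) \<ge> y"
        using nevanlinnaD(2)[OF g z(1)] \<phi> z by simp
      \<comment> \<open>The value of f at w = z + \<phi> g z is g z. As |z - w| = \<phi> |g z| \<le>
        \<phi> y while both imaginary parts are at least y, \<phi>^2 is an admissible Harnack
        constant at every such height.\<close>
      have "cmod (f z) \<le> (2 + \<phi>\<^sup>2) * cmod (f (z + of_real \<phi> * g z))"
      proof (rule schwarz_pick_growth[OF holf Imf])
        have "cmod (z - (z + of_real \<phi> * g z)) = \<phi> * cmod (g z)" using \<phi> by (simp add: norm_mult)
        then have "(cmod (z - (z + of_real \<phi> * g z)))\<^sup>2 = \<phi>\<^sup>2 * (cmod (g z) * cmod (g z))"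
          by (simp add: power_mult_distrib power2_eq_square)
        also have "\<dots> \<le> \<phi>\<^sup>2 * (Im z * Im (z + of_real \<phi> * g z))"
          using gz Imw z by (intro mult_left_mono mult_mono) auto
        finally show "(cmod (z - (z + of_real \<phi> * g z)))\<^sup>2 \<le> \<phi>\<^sup>2 * (Im z * Im (z + of_real \<phi> * g z))" .
      qed (use z Imw in auto)
      also have "f (z + of_real \<phi> * g z) = g z" by (rule fg[OF z(1)])
      finally show ?case using elim by (simp add: norm_divide z_def divide_right_mono)
    qed
    have "((\<lambda>y. (2 + \<phi>\<^sup>2) * norm (g (\<i> * of_real y) / of_real y)) \<longlongrightarrow> (2 + \<phi>\<^sup>2) * norm (0::complex)) at_top"
      by (intro tendsto_intros nevanlinnaD(3)[OF g])
    then show "((\<lambda>y. (2 + \<phi>\<^sup>2) * norm (g (\<i> * of_real y) / of_real y)) \<longlongrightarrow> 0) at_top" by simp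
  qed
  then have "nevanlinna f" using holf Imf by (simp add: nevanlinna_def)
  then show ?thesis using fg by (rule that)
qed

theorem mainTheorem9:
  fixes \<mu> :: "real measure"
  assumes "\<mu> \<in> borel_probs"
    and "0 < free_div_indicator \<mu>" and "free_div_indicator \<mu> < 1"
  shows "\<forall>t::real. 1 - free_div_indicator \<mu> \<le> ereal t \<and> t \<le> 1 \<longrightarrow>
           (\<exists>\<nu>\<in>borel_probs. is_free_power \<mu> t \<nu>)"
proof (intro allI impI)
  fix t :: real assume t: "1 - free_div_indicator \<mu> \<le> ereal t \<and> t \<le> 1"
  define T where "T = {s. 0 \<le> s \<and> \<mu> \<in> BB s ` borel_probs}"
  obtain \<phi> where \<phi>: "free_div_indicator \<mu> = ereal \<phi>" "0 < \<phi>" "\<phi> < 1"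
    using assms(2,3) by (cases "free_div_indicator \<mu>") auto
  have sup: "(SUP s\<in>T. ereal s) = ereal \<phi>"
    using \<phi>(1) by (simp add: free_div_indicator_def T_def)
  \<comment> \<open>Membership of \<phi> itself in T is never shown: the functional identity at
    \<phi>, obtained as a limit along members of T, is what the rest uses.\<close>
  have "\<exists>s\<in>T. \<phi> - 1 / real (Suc n) < s \<and> s \<le> \<phi>" for n
  proof -
    have "ereal (\<phi> - 1 / real (Suc n)) < (SUP s\<in>T. ereal s)" unfolding sup by simp
    then obtain s where s: "s \<in> T" "\<phi> - 1 / real (Suc n) < s" unfolding less_SUP_iff by auto
    have "ereal s \<le> (SUP s\<in>T. ereal s)" using s(1) by (rule SUP_upper)
    then show ?thesis using s sup by auto
  qed
  then obtain s where s: "\<And>n. s n \<in> T" "\<And>n. \<phi> - 1 / real (Suc n) < s n" "\<And>n. s n \<le> \<phi>" by metis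
  have s_lim: "s \<longlonglongrightarrow> \<phi>"
  proof (rule tendsto_sandwich[where h = "\<lambda>_. \<phi>"])
    have "(\<lambda>n. \<phi> - 1 / real (Suc n)) \<longlonglongrightarrow> \<phi> - 0"
      using LIMSEQ_inverse_real_of_nat by (intro tendsto_intros) (simp add: inverse_eq_divide)
    then show "(\<lambda>n. \<phi> - 1 / real (Suc n)) \<longlonglongrightarrow> \<phi>" by simp
  qed (use s(2,3) in \<open>auto intro: always_eventually less_imp_le\<close>)
  define g where "g = (\<lambda>z. recip_cauchy \<mu> z - z)"
  have g: "nevanlinna g" unfolding g_def by (rule nevanlinna_recip_cauchy_borel_probs[OF assms(1)])
  have "\<exists>f. nevanlinna f \<and> (\<forall>z. Im z > 0 \<longrightarrow> f (z + of_real (s n) * g z) = g z)" for n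
  proof -
    obtain \<rho> where \<rho>: "\<rho> \<in> borel_probs" "\<mu> = BB (s n) \<rho>" and sn: "s n \<ge> 0"
      using s(1)[of n] by (auto simp: T_def)
    show ?thesis unfolding g_def \<rho>(2) by (rule BB_subordination[OF \<rho>(1) sn]) blast
  qed
  then obtain F where F: "\<And>n. nevanlinna (F n)"
    "\<And>n z. Im z > 0 \<Longrightarrow> F n (z + of_real (s n) * g z) = g z" by metis
  obtain f where f: "nevanlinna f" and fg: "\<And>z. Im z > 0 \<Longrightarrow> f (z + of_real \<phi> * g z) = g z"
    by (rule subordination_limit[OF g F(1) _ s_lim F(2)]) (use s(1) in \<open>auto simp: T_def\<close>)
  obtain \<omega> where \<omega>:
    "\<And>w. Im w > 0 \<Longrightarrow> Im (w - of_real \<phi> * f w) > 0 \<Longrightarrow> \<omega> (w - of_real \<phi> * f w) = w"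
    by (rule nevanlinna_subordination[OF nevanlinna_cmult[OF f, of \<phi>]]) (use \<phi> in auto)
  have \<mu>: "subordination_param f \<phi> 1 \<mu>"
    unfolding subordination_param_def
  proof (intro conjI allI impI assms(1))
    fix w assume w: "Im w > 0" "Im (w - of_real \<phi> * f w) > 0"
    define z where "z = w - of_real \<phi> * f w"
    define w' where "w' = z + of_real \<phi> * g z"
    have z: "Im z > 0" using w by (simp add: z_def)
    have "Im w' > 0" using nevanlinnaD(2)[OF g z] \<phi> z by (simp add: w'_def add_pos_nonneg)
    moreover have w'z: "w' - of_real \<phi> * f w' = z" using fg[OF z] by (simp add: w'_def)
    \<comment> \<open>Both w' and w are sent to z by \<open>id - \<phi> f\<close>, and \<omega> is a
      left inverse at both, so they coincide; this gives g z = f w.\<close>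
    ultimately have "\<omega> z = w'" using \<omega>[of w'] z by simp
    moreover have "\<omega> z = w" using \<omega>[OF w] by (simp add: z_def)
    ultimately have "g z = f w" using fg[OF z] by (simp add: w'_def)
    then have "recip_cauchy \<mu> z = z + f w" by (simp add: g_def algebra_simps)
    then show "recip_cauchy \<mu> (w - of_real \<phi> * f w) = w + of_real (1 - \<phi>) * f w"
      unfolding z_def[symmetric] by (simp add: z_def algebra_simps)
  qed
  \<comment> \<open>Supplies both signs required by \<open>subordination_param_exists\<close>: the
    first parameter is nonnegative, and t \<ge> 1 - \<phi> > 0.\<close>
  have t\<phi>: "1 - \<phi> \<le> t" using t unfolding \<phi>(1) by (simp add: one_ereal_def)
  obtain \<nu> where \<nu>: "subordination_param f (t - (1 - \<phi>)) t \<nu>"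
    using subordination_param_exists[OF f, of "t - (1 - \<phi>)" t] t\<phi> \<phi> by auto
  have "is_free_power \<mu> (t / 1) \<nu>"
    by (rule subordination_param_free_power[OF f \<mu> \<nu>]) auto
  then show "\<exists>\<nu>\<in>borel_probs. is_free_power \<mu> t \<nu>"
    using \<nu> by (auto simp: subordination_param_def)
qed

end
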